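(* For any matroid $M$ on a ground set of $n$ elements, $$S(F(M,\mathbf{x}))=(-1)^nF^\ast(M,\mathbf{x}),$$ and consequently, as polynomials in $m$, $\phi(M,-m)=(-1)^n\phi^\ast(M,m)$.
   Context: For a matroid $M$ on finite ground set $E$ with bases $\mathcal{B}(M)$ and $f:E\to\mathbb{P}=\{1,2,\ldots\}$, a base $B$ is $f$-minimizing if $f(B)=\sum_{e\in B}f(e)$ is minimal among all bases, and $f$ is $M$-generic if there is exactly one $f$-minimizing base. Define $F(M,\mathbf{x})=\sum_{f\ M\text{-generic}}\prod_{e\in E}x_{f(e)}$ and $$F^\ast(M,\mathbf{x})=\sum_{f:E\to\mathbb{P}}\bigl|\{f\text{-minimizing bases of }M\}\bigr|\prod_{e\in E}x_{f(e)}.$$ Let $\phi(M,m)$ and $\phi^\ast(M,m)$ be the specializations of $F(M,\mathbf{x})$ and $F^\ast(M,\mathbf{x})$ at $x_1=\cdots=x_m=1$, $x_{m+1}=x_{m+2}=\cdots=0$; these are polynomial functions of the positive integer $m$. $S$ denotes the antipode of the Hopf algebra of quasisymmetric functions over $\mathbb{Z}$ (product of power series; coproduct $g\mapsto\sum g_i\otimes h_i$ where $g(x_1,x_2,\ldots,y_1,y_2,\ldots)=\sum g_i(\mathbf{x})h_i(\mathbf{y})$ in the ordered alphabet $x_1<x_2<\cdots<y_1<y_2<\cdots$). Explicitly, $S(L_\alpha)=(-1)^{|\alpha|}L_{\alpha^c}$, where $L_\alpha=\sum_{\beta\text{ refining }\alpha}M_\beta$ is the fundamental quasisymmetric function, $|\alpha|$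 the sum of the parts of $\alpha$, and $\alpha^c$ the composition of $|\alpha|$ whose set of partial sums is the complement in $\{1,\ldots,|\alpha|-1\}$ of the set of partial sums of $\alpha$.
   Formalization: S is the linear map given by the explicit formula S(L_α)=(-1)^{|α|}L_{α^c} (complement not reversed); it is not the Hopf antipode of the stated coproduct, which also reverses α^c and for which the identity fails, e.g. for the uniform matroid U_{1,3}. *)

theory Defs
  imports
    "HOL-Library.Multiset"
    "HOL-Library.FuncSet"
    "HOL-Computational_Algebra.Polynomial"
begin

section \<open>Matroids and minimizing bases\<close>

definition matroid :: "'a set \<Rightarrow> 'a set set \<Rightarrow> bool" where
  "matroid E \<B> \<longleftrightarrow> finite E \<and> \<B> \<subseteq> Pow E \<and> \<B> \<noteq> {} \<and>
     (\<forall>A\<in>\<B>. \<forall>B\<in>\<B>. \<forall>a\<in>A - B. \<exists>b\<in>B - A. insert b (A - {a}) \<in> \<B>)"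

definition minimizing_bases :: "'a set set \<Rightarrow> ('a \<Rightarrow> nat) \<Rightarrow> 'a set set" where
  "minimizing_bases \<B> f = {B \<in> \<B>. \<forall>B'\<in>\<B>. (\<Sum>e\<in>B. f e) \<le> (\<Sum>e\<in>B'. f e)}"

definition generic :: "'a set set \<Rightarrow> ('a \<Rightarrow> nat) \<Rightarrow> bool" where
  "generic \<B> f \<longleftrightarrow> (\<exists>!B. B \<in> minimizing_bases \<B> f)"


section \<open>Formal power series in \<open>x\<^sub>1, x\<^sub>2, \<dots>\<close>\<close>

text \<open>
  A monomial is the multiset of the indices of its variables, so \<open>{#1, 1, 3#}\<close> is
  \<open>x\<^sub>1 x\<^sub>1 x\<^sub>3\<close>; a power series is its coefficient function. There is no variable
  \<open>x\<^sub>0\<close>: all series below vanish on multisets containing \<open>0\<close>.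
\<close>

type_synonym monom = "nat multiset"
type_synonym pseries = "nat multiset \<Rightarrow> int"

definition weight_monom :: "'a set \<Rightarrow> ('a \<Rightarrow> nat) \<Rightarrow> monom" where
  "weight_monom E f = image_mset f (mset_set E)"

definition matroid_F :: "'a set \<Rightarrow> 'a set set \<Rightarrow> pseries" where
  "matroid_F E \<B> = (\<lambda>\<mu>. int (card {f \<in> E \<rightarrow>\<^sub>E {1..}. generic \<B> f \<and> weight_monom E f = \<mu>}))"

definition matroid_Fstar :: "'a set \<Rightarrow> 'a set set \<Rightarrow> pseries" where
  "matroid_Fstar E \<B> =
     (\<lambda>\<mu>. \<Sum>f | f \<in> E \<rightarrow>\<^sub>E {1..} \<and> weight_monom E f = \<mu>. int (card (minimizing_bases \<B> f)))"

text \<open>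
  The value at \<open>x\<^sub>1 = \<dots> = x\<^sub>m = 1\<close>, \<open>x\<^sub>m\<^sub>+\<^sub>1 = x\<^sub>m\<^sub>+\<^sub>2 = \<dots> = 0\<close>. The sum is finite for
  every series of bounded degree.
\<close>

definition specialize :: "pseries \<Rightarrow> nat \<Rightarrow> int" where
  "specialize g m = (\<Sum>\<mu> | set_mset \<mu> \<subseteq> {1..m} \<and> g \<mu> \<noteq> 0. g \<mu>)"

definition phi :: "'a set \<Rightarrow> 'a set set \<Rightarrow> nat \<Rightarrow> int" where
  "phi E \<B> m = specialize (matroid_F E \<B>) m"

definition phi_star :: "'a set \<Rightarrow> 'a set set \<Rightarrow> nat \<Rightarrow> int" where
  "phi_star E \<B> m = specialize (matroid_Fstar E \<B>) m"


section \<open>Quasisymmetric functions\<close>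

definition composition :: "nat list \<Rightarrow> bool" where
  "composition \<alpha> \<longleftrightarrow> 0 \<notin> set \<alpha>"

text \<open>The total \<open>|\<alpha>|\<close> is not counted as a partial sum.\<close>

definition partial_sums :: "nat list \<Rightarrow> nat set" where
  "partial_sums \<alpha> = {sum_list (take k \<alpha>) | k. 0 < k \<and> k < length \<alpha>}"

definition refines :: "nat list \<Rightarrow> nat list \<Rightarrow> bool" where
  "refines \<beta> \<alpha> \<longleftrightarrow> sum_list \<beta> = sum_list \<alpha> \<and> partial_sums \<alpha> \<subseteq> partial_sums \<beta>"

definition compl_composition :: "nat list \<Rightarrow> nat list" where
  "compl_composition \<alpha> = (THE \<beta>. composition \<beta> \<and> sum_list \<beta> = sum_list \<alpha> \<and>
     partial_sums \<beta> = {1..<sum_list \<alpha>} - partial_sums \<alpha>)"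

definition increasing_indices :: "nat list \<Rightarrow> bool" where
  "increasing_indices is \<longleftrightarrow> sorted_wrt (<) is \<and> 0 \<notin> set is"

text \<open>\<open>power_monom [a\<^sub>1, \<dots>, a\<^sub>k] [i\<^sub>1, \<dots>, i\<^sub>k]\<close> is the product of the \<open>a\<^sub>j\<close>-th powers of
  \<open>x\<^bsub>i\<^sub>j\<^esub>\<close>.\<close>

definition power_monom :: "nat list \<Rightarrow> nat list \<Rightarrow> monom" where
  "power_monom \<alpha> is = sum_list (map2 replicate_mset \<alpha> is)"

definition quasisymmetric :: "pseries \<Rightarrow> bool" where
  "quasisymmetric g \<longleftrightarrow>
     (\<forall>\<mu>. 0 \<in># \<mu> \<longrightarrow> g \<mu> = 0) \<and>
     (\<exists>d. \<forall>\<mu>. g \<mu> \<noteq> 0 \<longrightarrow> size \<mu> \<le> d) \<and>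
     (\<forall>\<alpha> is js. composition \<alpha> \<and> increasing_indices is \<and> increasing_indices js \<and>
        length is = length \<alpha> \<and> length js = length \<alpha> \<longrightarrow>
        g (power_monom \<alpha> is) = g (power_monom \<alpha> js))"

definition monomial_qsym :: "nat list \<Rightarrow> pseries" where
  "monomial_qsym \<alpha> = (\<lambda>\<mu>. if \<exists>is. increasing_indices is \<and> length is = length \<alpha> \<and>
     \<mu> = power_monom \<alpha> is then 1 else 0)"

definition fundamental_qsym :: "nat list \<Rightarrow> pseries" where
  "fundamental_qsym \<alpha> = (\<lambda>\<mu>. \<Sum>\<beta> | composition \<beta> \<and> refines \<beta> \<alpha>. monomial_qsym \<beta> \<mu>)"

definition fundamental_expansion :: "pseries \<Rightarrow> (nat list \<Rightarrow> int) \<Rightarrow> bool" where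
  "fundamental_expansion g c \<longleftrightarrow>
     finite {\<alpha>. c \<alpha> \<noteq> 0} \<and> (\<forall>\<alpha>. c \<alpha> \<noteq> 0 \<longrightarrow> composition \<alpha>) \<and>
     g = (\<lambda>\<mu>. \<Sum>\<alpha> | c \<alpha> \<noteq> 0. c \<alpha> * fundamental_qsym \<alpha> \<mu>)"

definition fundamental_coeff :: "pseries \<Rightarrow> nat list \<Rightarrow> int" where
  "fundamental_coeff g = (THE c. fundamental_expansion g c)"

text \<open>
  The antipode is the \<open>\<int>\<close>-linear map with \<open>S L\<^sub>\<alpha> = (-1)\<^bsup>|\<alpha>|\<^esup> L\<^bsub>\<alpha>\<^sup>c\<^esub>\<close>, see
  \<open>antipode_fundamental\<close> and \<open>antipode_lincomb\<close> below; it is meant for quasisymmetric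
  arguments only. Pitfall: the complement \<open>\<alpha>\<^sup>c\<close> is not reversed here. The convolution
  inverse of the identity for the ordered-alphabet coproduct is this map followed by the
  reversal of compositions, and the reciprocity between \<open>F\<close> and \<open>F\<^sup>*\<close> fails for that map,
  e.g. for the uniform matroid of rank 1 on 3 elements.
\<close>

definition antipode :: "pseries \<Rightarrow> pseries" where
  "antipode g = (\<lambda>\<mu>. \<Sum>\<alpha> | fundamental_coeff g \<alpha> \<noteq> 0.
     fundamental_coeff g \<alpha> * ((-1) ^ sum_list \<alpha> * fundamental_qsym (compl_composition \<alpha>) \<mu>))"


section \<open>Well-definedness\<close>

lemma partial_sums_Nil [simp]: "partial_sums [] = {}"
  and partial_sums_single [simp]: "partial_sums [a] = {}"
  by (auto simp: partial_sums_def)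

lemma partial_sums_Cons2:
  "partial_sums (a # b # \<alpha>) = insert a ((+) a ` partial_sums (b # \<alpha>))"
proof -
  have "partial_sums (a # b # \<alpha>) = (\<lambda>k. sum_list (take k (a # b # \<alpha>))) ` {0<..<Suc (length (b # \<alpha>))}"
    by (auto simp: partial_sums_def)
  also have "{0<..<Suc (length (b # \<alpha>))} = insert 1 (Suc ` {0<..<length (b # \<alpha>)})"
  proof -
    have "x \<in> insert 1 (Suc ` {0<..<length (b # \<alpha>)})"
      if "x \<in> {0<..<Suc (length (b # \<alpha>))}" for x
      using that by (cases x; cases "x = 1") auto
    moreover have "insert 1 (Suc ` {0<..<length (b # \<alpha>)}) \<subseteq> {0<..<Suc (length (b # \<alpha>))}"
      by auto
    ultimately show ?thesis by blast
  qed
  also have "(\<lambda>k. sum_list (take k (a # b # \<alpha>))) ` \<dots> =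
      insert a ((+) a ` (\<lambda>k. sum_list (take k (b # \<alpha>))) ` {0<..<length (b # \<alpha>)})"
    by (simp add: image_image)
  also have "(\<lambda>k. sum_list (take k (b # \<alpha>))) ` {0<..<length (b # \<alpha>)} = partial_sums (b # \<alpha>)"
    by (auto simp: partial_sums_def)
  finally show ?thesis .
qed

lemma composition_Cons [simp]: "composition (a # \<alpha>) \<longleftrightarrow> 0 < a \<and> composition \<alpha>"
  and composition_Nil [simp]: "composition []"
  by (auto simp: composition_def)

lemma composition_sum_0: "composition \<alpha> \<Longrightarrow> sum_list \<alpha> = 0 \<longleftrightarrow> \<alpha> = []"
  by (cases \<alpha>) auto

lemma partial_sums_range: "composition \<alpha> \<Longrightarrow> partial_sums \<alpha> \<subseteq> {1..<sum_list \<alpha>}"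
proof (induction \<alpha> rule: induct_list012)
  case (3 a b \<alpha>)
  thus ?case by (fastforce simp: partial_sums_Cons2)
qed auto

lemma card_partial_sums: "composition \<alpha> \<Longrightarrow> card (partial_sums \<alpha>) = length \<alpha> - 1"
proof (induction \<alpha> rule: induct_list012)
  case (3 a b \<alpha>)
  have fin: "finite (partial_sums (b # \<alpha>))"
    using finite_subset[OF partial_sums_range] 3 by auto
  have "a \<notin> (+) a ` partial_sums (b # \<alpha>)"
    using partial_sums_range[of "b # \<alpha>"] 3 by auto
  with fin 3 show ?case
    by (simp add: partial_sums_Cons2 card_image)
qed auto

lemma composition_eqI:
  "\<lbrakk>composition \<alpha>; composition \<beta>; sum_list \<alpha> = sum_list \<beta>; partial_sums \<alpha> = partial_sums \<beta>\<rbrakk>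
    \<Longrightarrow> \<alpha> = \<beta>"
proof (induction \<alpha> arbitrary: \<beta> rule: induct_list012)
  case 1
  thus ?case using composition_sum_0[of \<beta>] by simp
next
  case (2 a)
  have "length \<beta> - 1 = 0" using card_partial_sums[of \<beta>] 2 by (metis partial_sums_single card.empty)
  with 2 show ?case by (cases \<beta>) auto
next
  case (3 a b \<alpha>)
  have len: "length \<beta> - 1 = length (a # b # \<alpha>) - 1"
    using card_partial_sums[of \<beta>] card_partial_sums[of "a # b # \<alpha>"] 3 by (metis)
  then obtain c d \<gamma> where \<beta>: "\<beta> = c # d # \<gamma>"
    by (metis One_nat_def Suc_length_conv diff_Suc_1 length_Cons list.size(3) nat.simps(3)
        list.exhaust zero_diff)
  have eq: "insert a ((+) a ` partial_sums (b # \<alpha>)) = insert c ((+) c ` partial_sums (d # \<gamma>))"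
    using 3 by (simp add: \<beta> partial_sums_Cons2)
  have ra: "\<forall>x\<in>partial_sums (b # \<alpha>). 0 < x" and rc: "\<forall>x\<in>partial_sums (d # \<gamma>). 0 < x"
    using partial_sums_range[of "b # \<alpha>"] partial_sums_range[of "d # \<gamma>"] 3 by (auto simp: \<beta>)
  have ac: "a = c"
  proof (rule antisym)
    have "c \<in> insert a ((+) a ` partial_sums (b # \<alpha>))" using eq by simp
    thus "a \<le> c" by auto
    have "a \<in> insert c ((+) c ` partial_sums (d # \<gamma>))" using eq by (metis insertI1)
    thus "c \<le> a" by auto
  qed
  have "(+) a ` partial_sums (b # \<alpha>) = (+) a ` partial_sums (d # \<gamma>)"
  proof -
    have "a \<notin> (+) a ` partial_sums (b # \<alpha>)" "a \<notin> (+) a ` partial_sums (d # \<gamma>)"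
      using ra rc by auto
    thus ?thesis using eq ac by (metis insert_ident)
  qed
  hence "partial_sums (b # \<alpha>) = partial_sums (d # \<gamma>)"
    by (simp add: inj_image_eq_iff)
  moreover have "composition (b # \<alpha>)" "composition (d # \<gamma>)" "sum_list (b # \<alpha>) = sum_list (d # \<gamma>)"
    using "3.prems" ac by (auto simp: \<beta>)
  ultimately have "b # \<alpha> = d # \<gamma>" using "3.IH"(2) by blast
  thus ?case using ac by (simp add: \<beta>)
qed

lemma composition_of_partial_sums:
  assumes "A \<subseteq> {1..<n}"
  shows "\<exists>\<beta>. composition \<beta> \<and> sum_list \<beta> = n \<and> partial_sums \<beta> = A"
  using assms
proof (induction n arbitrary: A rule: less_induct)
  case (less n)
  show ?case
  proof (cases "A = {}")
    case True
    show ?thesis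
      by (rule exI[of _ "if n = 0 then [] else [n]"]) (auto simp: True)
  next
    case False
    define a where "a = Min A"
    have fin: "finite A" using less.prems finite_subset by blast
    have a: "a \<in> A" "\<And>x. x \<in> A \<Longrightarrow> a \<le> x" using fin False by (auto simp: a_def)
    have a0: "0 < a" "a < n" using a less.prems by auto
    define A' where "A' = (\<lambda>x. x - a) ` (A - {a})"
    have "A' \<subseteq> {1..<n - a}" using a less.prems by (fastforce simp: A'_def)
    then obtain \<beta> where \<beta>: "composition \<beta>" "sum_list \<beta> = n - a" "partial_sums \<beta> = A'"
      using less.IH[of "n - a" A'] a0 by auto
    then obtain b \<gamma> where b: "\<beta> = b # \<gamma>" using a0 by (cases \<beta>) auto
    have "(+) a ` A' = A - {a}"
      using a by (force simp: A'_def image_image)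
    hence "partial_sums (a # \<beta>) = A"
      using \<beta> a by (auto simp: b partial_sums_Cons2)
    thus ?thesis using \<beta> a0 by (intro exI[of _ "a # \<beta>"]) auto
  qed
qed

lemma compl_composition:
  assumes "composition \<alpha>"
  shows "composition (compl_composition \<alpha>)"
    and "sum_list (compl_composition \<alpha>) = sum_list \<alpha>"
    and "partial_sums (compl_composition \<alpha>) = {1..<sum_list \<alpha>} - partial_sums \<alpha>"
proof -
  have "\<exists>!\<beta>. composition \<beta> \<and> sum_list \<beta> = sum_list \<alpha> \<and>
     partial_sums \<beta> = {1..<sum_list \<alpha>} - partial_sums \<alpha>"
    using composition_of_partial_sums[of "{1..<sum_list \<alpha>} - partial_sums \<alpha>" "sum_list \<alpha>"]
      composition_eqI by (metis Diff_subset)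
  from theI'[OF this] show "composition (compl_composition \<alpha>)"
    "sum_list (compl_composition \<alpha>) = sum_list \<alpha>"
    "partial_sums (compl_composition \<alpha>) = {1..<sum_list \<alpha>} - partial_sums \<alpha>"
    by (auto simp: compl_composition_def)
qed

lemma refines_refl [simp]: "refines \<alpha> \<alpha>"
  by (simp add: refines_def)

lemma refines_length_less:
  assumes "composition \<alpha>" "composition \<beta>" "refines \<beta> \<alpha>" "\<alpha> \<noteq> \<beta>"
  shows "length \<alpha> < length \<beta>"
proof -
  have "partial_sums \<alpha> \<subset> partial_sums \<beta>"
    using assms composition_eqI[of \<alpha> \<beta>] by (auto simp: refines_def)
  hence "card (partial_sums \<alpha>) < card (partial_sums \<beta>)"
    using partial_sums_range[of \<beta>] assms
    by (meson finite_atLeastLessThan finite_subset psubset_card_mono)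
  thus ?thesis using assms by (simp add: card_partial_sums)
qed

lemma length_le_sum: "composition \<alpha> \<Longrightarrow> length \<alpha> \<le> sum_list \<alpha>"
  by (induction \<alpha>) auto

lemma finite_compositions: "finite {\<alpha>. composition \<alpha> \<and> sum_list \<alpha> \<le> n}"
proof (rule finite_subset)
  show "{\<alpha>. composition \<alpha> \<and> sum_list \<alpha> \<le> n} \<subseteq> {\<alpha>. set \<alpha> \<subseteq> {..n} \<and> length \<alpha> \<le> n}"
    by (auto intro: order_trans[OF length_le_sum] order_trans[OF member_le_sum_list])
  show "finite {\<alpha>. set \<alpha> \<subseteq> {..n} \<and> length \<alpha> \<le> n}"
    by (rule finite_lists_length_le) simp
qed

lemma finite_refinements: "finite {\<beta>. composition \<beta> \<and> refines \<beta> \<alpha>}"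
  by (rule finite_subset[OF _ finite_compositions[of "sum_list \<alpha>"]]) (auto simp: refines_def)

definition monom_shape :: "monom \<Rightarrow> nat list" where
  "monom_shape \<mu> = map (count \<mu>) (sorted_list_of_set (set_mset \<mu>))"

lemma composition_monom_shape [simp]: "composition (monom_shape \<mu>)"
  by (auto simp: composition_def monom_shape_def count_eq_zero_iff)

lemma set_power_monom:
  "length is = length \<alpha> \<Longrightarrow> composition \<alpha> \<Longrightarrow> set_mset (power_monom \<alpha> is) = set is"
  by (induction "is" \<alpha> rule: list_induct2) (auto simp: power_monom_def)

lemma map_count_power_monom:
  "length is = length \<alpha> \<Longrightarrow> composition \<alpha> \<Longrightarrow> distinct is \<Longrightarrow>
     map (count (power_monom \<alpha> is)) is = \<alpha>"
proof (induction "is" \<alpha> rule: list_induct2)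
  case (Cons i "is" a \<alpha>)
  have "i \<notin># power_monom \<alpha> is" using Cons set_power_monom[of "is" \<alpha>] by auto
  moreover have "map (count (replicate_mset a i + power_monom \<alpha> is)) is = map (count (power_monom \<alpha> is)) is"
    using Cons.prems by (intro map_cong[OF refl]) auto
  moreover have "power_monom (a # \<alpha>) (i # is) = replicate_mset a i + power_monom \<alpha> is"
    by (simp add: power_monom_def)
  moreover have "count (replicate_mset a i + power_monom \<alpha> is) i = a"
    using calculation(1) by (simp add: not_in_iff)
  moreover have "map (count (power_monom \<alpha> is)) is = \<alpha>"
    using Cons by simp
  ultimately show ?case by (simp only: list.map)
qed (simp add: power_monom_def)

lemma monom_shape_power_monom:
  assumes "length is = length \<alpha>" "composition \<alpha>" "increasing_indices is"
  shows "monom_shape (power_monom \<alpha> is) = \<alpha>"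
proof -
  have "sorted_list_of_set (set is) = is"
    using assms by (simp add: increasing_indices_def strict_sorted_equal)
  thus ?thesis using assms
    by (simp add: monom_shape_def set_power_monom map_count_power_monom increasing_indices_def
        strict_sorted_iff)
qed

lemma power_monom_shape: "power_monom (monom_shape \<mu>) (sorted_list_of_set (set_mset \<mu>)) = \<mu>"
proof -
  have "power_monom (map (count \<mu>) is) is = filter_mset (\<lambda>x. x \<in> set is) \<mu>"
    if "distinct is" for "is"
    using that
  proof (induction "is")
    case (Cons i "is")
    have "filter_mset (\<lambda>x. x = i \<or> x \<in> set is) \<mu> =
        replicate_mset (count \<mu> i) i + filter_mset (\<lambda>x. x \<in> set is) \<mu>"
      using Cons by (auto intro!: multiset_eqI)
    with Cons show ?case by (simp add: power_monom_def)
  qed (simp add: power_monom_def)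
  from this[of "sorted_list_of_set (set_mset \<mu>)"] show ?thesis
    by (simp add: monom_shape_def filter_mset_eq_conv)
qed

lemma monomial_qsym_eq:
  assumes "composition \<alpha>"
  shows "monomial_qsym \<alpha> \<mu> = of_bool (0 \<notin># \<mu> \<and> monom_shape \<mu> = \<alpha>)"
proof -
  have "(\<exists>is. increasing_indices is \<and> length is = length \<alpha> \<and> \<mu> = power_monom \<alpha> is) \<longleftrightarrow>
      0 \<notin># \<mu> \<and> monom_shape \<mu> = \<alpha>" (is "?L \<longleftrightarrow> ?R")
  proof
    assume ?L
    thus ?R using assms set_power_monom monom_shape_power_monom
      by (metis increasing_indices_def)
  next
    assume R: ?R
    show ?L
      by (rule exI[of _ "sorted_list_of_set (set_mset \<mu>)"])
        (use R power_monom_shape[of \<mu>] in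
          \<open>auto simp: increasing_indices_def monom_shape_def\<close>)
  qed
  thus ?thesis by (simp add: monomial_qsym_def)
qed

lemma fundamental_qsym_eq:
  "fundamental_qsym \<alpha> \<mu> = of_bool (0 \<notin># \<mu> \<and> refines (monom_shape \<mu>) \<alpha>)"
proof -
  have "fundamental_qsym \<alpha> \<mu> =
      (\<Sum>\<beta> | composition \<beta> \<and> refines \<beta> \<alpha>. if monom_shape \<mu> = \<beta> then of_bool (0 \<notin># \<mu>) else 0)"
    unfolding fundamental_qsym_def by (intro sum.cong) (auto simp: monomial_qsym_eq)
  also have "\<dots> = of_bool (0 \<notin># \<mu> \<and> refines (monom_shape \<mu>) \<alpha>)"
    by (subst sum.delta') (auto simp: finite_refinements)
  finally show ?thesis .
qed

abbreviation std_monom :: "nat list \<Rightarrow> monom" where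
  "std_monom \<alpha> \<equiv> power_monom \<alpha> [1..<Suc (length \<alpha>)]"

lemma std_monom:
  assumes "composition \<alpha>"
  shows "monom_shape (std_monom \<alpha>) = \<alpha>" "0 \<notin># std_monom \<alpha>"
proof -
  have *: "increasing_indices [1..<Suc (length \<alpha>)]" "length [1..<Suc (length \<alpha>)] = length \<alpha>"
    by (auto simp: increasing_indices_def simp del: upt_Suc)
  show "monom_shape (std_monom \<alpha>) = \<alpha>"
    using monom_shape_power_monom[OF *(2) assms *(1)] .
  show "0 \<notin># std_monom \<alpha>"
    using set_power_monom[OF *(2) assms] by auto
qed

lemma fundamental_expansion_unique:
  assumes "fundamental_expansion g c" "fundamental_expansion g d"
  shows "c = d"
proof -
  define K where "K = {\<alpha>. c \<alpha> \<noteq> 0} \<union> {\<alpha>. d \<alpha> \<noteq> 0}"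
  have finK: "finite K" and K: "\<And>\<alpha>. \<alpha> \<in> K \<Longrightarrow> composition \<alpha>"
    using assms by (auto simp: K_def fundamental_expansion_def)
  have gc: "g \<mu> = (\<Sum>\<alpha>\<in>K. c \<alpha> * fundamental_qsym \<alpha> \<mu>)" for \<mu>
  proof -
    have "g \<mu> = (\<Sum>\<alpha> | c \<alpha> \<noteq> 0. c \<alpha> * fundamental_qsym \<alpha> \<mu>)"
      using assms(1) unfolding fundamental_expansion_def by metis
    also have "\<dots> = (\<Sum>\<alpha>\<in>K. c \<alpha> * fundamental_qsym \<alpha> \<mu>)"
      by (rule sum.mono_neutral_left) (use finK in \<open>auto simp: K_def\<close>)
    finally show ?thesis .
  qed
  have gd: "g \<mu> = (\<Sum>\<alpha>\<in>K. d \<alpha> * fundamental_qsym \<alpha> \<mu>)" for \<mu>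
  proof -
    have "g \<mu> = (\<Sum>\<alpha> | d \<alpha> \<noteq> 0. d \<alpha> * fundamental_qsym \<alpha> \<mu>)"
      using assms(2) unfolding fundamental_expansion_def by metis
    also have "\<dots> = (\<Sum>\<alpha>\<in>K. d \<alpha> * fundamental_qsym \<alpha> \<mu>)"
      by (rule sum.mono_neutral_left) (use finK in \<open>auto simp: K_def\<close>)
    finally show ?thesis .
  qed
  have "c \<alpha> = d \<alpha>" for \<alpha>
  proof (induction "length \<alpha>" arbitrary: \<alpha> rule: less_induct)
    case less
    show ?case
    proof (cases "\<alpha> \<in> K")
      case True
      note \<alpha> = K[OF True]
      have "0 = (\<Sum>\<gamma>\<in>K. (c \<gamma> - d \<gamma>) * fundamental_qsym \<gamma> (std_monom \<alpha>))"
        using gc[of "std_monom \<alpha>"] gd[of "std_monom \<alpha>"]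
        by (simp add: left_diff_distrib sum_subtractf)
      also have "\<dots> = (\<Sum>\<gamma>\<in>K. if \<gamma> = \<alpha> then c \<alpha> - d \<alpha> else 0)"
      proof (rule sum.cong[OF refl])
        fix \<gamma> assume "\<gamma> \<in> K"
        have "c \<gamma> - d \<gamma> = 0" if "\<gamma> \<noteq> \<alpha>" "refines \<alpha> \<gamma>"
          using less refines_length_less[OF K[OF \<open>\<gamma> \<in> K\<close>] \<alpha>] that by auto
        thus "(c \<gamma> - d \<gamma>) * fundamental_qsym \<gamma> (std_monom \<alpha>) = (if \<gamma> = \<alpha> then c \<alpha> - d \<alpha> else 0)"
          using std_monom[OF \<alpha>] by (auto simp: fundamental_qsym_eq simp del: upt_Suc)
      qed
      also have "\<dots> = c \<alpha> - d \<alpha>" using True finK by simp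
      finally show ?thesis by simp
    qed (auto simp: K_def)
  qed
  thus ?thesis by blast
qed

lemma fundamental_coeff_eq: "fundamental_expansion g c \<Longrightarrow> fundamental_coeff g = c"
  unfolding fundamental_coeff_def using fundamental_expansion_unique by blast

lemma fundamental_expansionI:
  assumes "finite K" "\<And>\<alpha>. \<alpha> \<in> K \<Longrightarrow> composition \<alpha>" "\<And>\<alpha>. \<alpha> \<notin> K \<Longrightarrow> c \<alpha> = 0"
    "\<And>\<mu>. g \<mu> = (\<Sum>\<alpha>\<in>K. c \<alpha> * fundamental_qsym \<alpha> \<mu>)"
  shows "fundamental_expansion g c"
proof -
  have sub: "{\<alpha>. c \<alpha> \<noteq> 0} \<subseteq> K" using assms(3) by blast
  have "(\<Sum>\<alpha>\<in>K. c \<alpha> * fundamental_qsym \<alpha> \<mu>) = (\<Sum>\<alpha> | c \<alpha> \<noteq> 0. c \<alpha> * fundamental_qsym \<alpha> \<mu>)" for \<mu>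
    by (rule sum.mono_neutral_right) (use assms sub in auto)
  thus ?thesis
    using assms sub finite_subset by (auto simp: fundamental_expansion_def)
qed

lemma fundamental_expansionD:
  assumes "fundamental_expansion g c" "finite K" "{\<alpha>. c \<alpha> \<noteq> 0} \<subseteq> K"
  shows "g \<mu> = (\<Sum>\<alpha>\<in>K. c \<alpha> * fundamental_qsym \<alpha> \<mu>)"
proof -
  have "g \<mu> = (\<Sum>\<alpha> | c \<alpha> \<noteq> 0. c \<alpha> * fundamental_qsym \<alpha> \<mu>)"
    using assms(1) unfolding fundamental_expansion_def by metis
  also have "\<dots> = (\<Sum>\<alpha>\<in>K. c \<alpha> * fundamental_qsym \<alpha> \<mu>)"
    by (rule sum.mono_neutral_left) (use assms in auto)
  finally show ?thesis .
qed

lemma fundamental_expansion_lincomb: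
  assumes "fundamental_expansion g c" "fundamental_expansion h d"
  shows "fundamental_expansion (\<lambda>\<mu>. a * g \<mu> + b * h \<mu>) (\<lambda>\<alpha>. a * c \<alpha> + b * d \<alpha>)"
proof -
  define K where "K = {\<alpha>. c \<alpha> \<noteq> 0} \<union> {\<alpha>. d \<alpha> \<noteq> 0}"
  have fin: "finite K" using assms by (auto simp: K_def fundamental_expansion_def)
  show ?thesis
  proof (rule fundamental_expansionI[of K])
    fix \<mu>
    show "a * g \<mu> + b * h \<mu> = (\<Sum>\<alpha>\<in>K. (a * c \<alpha> + b * d \<alpha>) * fundamental_qsym \<alpha> \<mu>)"
      using fundamental_expansionD[OF assms(1) fin] fundamental_expansionD[OF assms(2) fin]
      by (simp add: K_def sum.distrib sum_distrib_left algebra_simps)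
  qed (use assms fin in \<open>auto simp: K_def fundamental_expansion_def\<close>)
qed

lemma fundamental_expansion_zero: "fundamental_expansion (\<lambda>_. 0) (\<lambda>_. 0)"
  by (rule fundamental_expansionI[of "{}"]) auto

lemma fundamental_expansion_fundamental:
  "composition \<alpha> \<Longrightarrow> fundamental_expansion (fundamental_qsym \<alpha>) (\<lambda>\<beta>. of_bool (\<beta> = \<alpha>))"
  by (rule fundamental_expansionI[of "{\<alpha>}"]) auto

lemma fundamental_expansion_sum:
  assumes "finite K" "\<And>k. k \<in> K \<Longrightarrow> \<exists>c. fundamental_expansion (g k) c"
  shows "\<exists>c. fundamental_expansion (\<lambda>\<mu>. \<Sum>k\<in>K. a k * g k \<mu>) c"
  using assms
proof (induction K rule: finite_induct)
  case empty
  thus ?case using fundamental_expansion_zero by auto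
next
  case (insert k K)
  then obtain c d where "fundamental_expansion (g k) c"
    "fundamental_expansion (\<lambda>\<mu>. \<Sum>k\<in>K. a k * g k \<mu>) d" by (meson insertCI)
  from fundamental_expansion_lincomb[OF this, of "a k" 1] show ?case
    using insert by auto
qed

lemma fundamental_expansion_monomial:
  assumes "composition \<alpha>"
  shows "\<exists>c. fundamental_expansion (monomial_qsym \<alpha>) c"
  using assms
proof (induction "sum_list \<alpha> - length \<alpha>" arbitrary: \<alpha> rule: less_induct)
  case less
  define K where "K = {\<beta>. composition \<beta> \<and> refines \<beta> \<alpha>} - {\<alpha>}"
  have fin: "finite K" using finite_refinements by (auto simp: K_def)
  have "\<exists>c. fundamental_expansion (monomial_qsym \<beta>) c" if "\<beta> \<in> K" for \<beta>
  proof (rule less.hyps)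
    have "length \<alpha> < length \<beta>" "composition \<beta>" "sum_list \<beta> = sum_list \<alpha>"
      using that refines_length_less less.prems by (auto simp: K_def refines_def)
    thus "sum_list \<beta> - length \<beta> < sum_list \<alpha> - length \<alpha>" "composition \<beta>"
      using length_le_sum[of \<beta>] by auto
  qed
  from fundamental_expansion_sum[OF fin this, of "\<lambda>\<beta>. \<beta>" "\<lambda>_. 1"]
  obtain c where c: "fundamental_expansion (\<lambda>\<mu>. \<Sum>\<beta>\<in>K. monomial_qsym \<beta> \<mu>) c" by auto
  have "fundamental_qsym \<alpha> \<mu> = monomial_qsym \<alpha> \<mu> + (\<Sum>\<beta>\<in>K. monomial_qsym \<beta> \<mu>)" for \<mu>
    unfolding fundamental_qsym_def K_def
    by (subst sum.remove[of _ \<alpha>]) (use finite_refinements less.prems in auto)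
  hence eq: "monomial_qsym \<alpha> =
      (\<lambda>\<mu>. 1 * fundamental_qsym \<alpha> \<mu> + (-1) * (\<Sum>\<beta>\<in>K. monomial_qsym \<beta> \<mu>))"
    by auto
  show ?case
    by (subst eq)
      (rule exI, rule fundamental_expansion_lincomb[OF fundamental_expansion_fundamental[OF less.prems] c])
qed

lemma size_eq_sum_monom_shape: "size \<mu> = sum_list (monom_shape \<mu>)"
  by (simp add: monom_shape_def size_multiset_overloaded_eq sum_list_distinct_conv_sum_set)

theorem quasisymmetric_fundamental_expansion:
  assumes "quasisymmetric g"
  shows "\<exists>!c. fundamental_expansion g c"
proof -
  from assms obtain d where d: "\<And>\<mu>. g \<mu> \<noteq> 0 \<Longrightarrow> size \<mu> \<le> d"
    by (auto simp: quasisymmetric_def)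
  have z: "g \<mu> = 0" if "0 \<in># \<mu>" for \<mu>
    using assms that by (auto simp: quasisymmetric_def)
  have q: "g \<mu> = g (std_monom (monom_shape \<mu>))" if "0 \<notin># \<mu>" for \<mu>
  proof -
    have "increasing_indices (sorted_list_of_set (set_mset \<mu>))"
      "increasing_indices [1..<Suc (length (monom_shape \<mu>))]"
      using that by (auto simp: increasing_indices_def simp del: upt_Suc)
    hence "g (power_monom (monom_shape \<mu>) (sorted_list_of_set (set_mset \<mu>))) =
        g (std_monom (monom_shape \<mu>))"
      using assms unfolding quasisymmetric_def
      by (metis composition_monom_shape diff_Suc_1 length_map length_upt monom_shape_def)
    thus ?thesis by (simp only: power_monom_shape)
  qed
  define K where "K = {\<alpha>. composition \<alpha> \<and> sum_list \<alpha> \<le> d}"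
  have fin: "finite K" using finite_compositions by (simp add: K_def)
  have "g \<mu> = (\<Sum>\<alpha>\<in>K. g (std_monom \<alpha>) * monomial_qsym \<alpha> \<mu>)" for \<mu>
  proof -
    have "(\<Sum>\<alpha>\<in>K. g (std_monom \<alpha>) * monomial_qsym \<alpha> \<mu>) =
        (\<Sum>\<alpha>\<in>K. if monom_shape \<mu> = \<alpha> then g \<mu> else 0)"
    proof (rule sum.cong[OF refl])
      fix \<alpha> assume "\<alpha> \<in> K"
      hence "composition \<alpha>" by (simp add: K_def)
      thus "g (std_monom \<alpha>) * monomial_qsym \<alpha> \<mu> = (if monom_shape \<mu> = \<alpha> then g \<mu> else 0)"
        using z[of \<mu>] q[of \<mu>] by (auto simp: monomial_qsym_eq simp del: upt_Suc)
    qed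
    also have "\<dots> = (if monom_shape \<mu> \<in> K then g \<mu> else 0)" using fin by simp
    also have "\<dots> = g \<mu>" using d[of \<mu>] by (auto simp: K_def size_eq_sum_monom_shape)
    finally show ?thesis by simp
  qed
  hence "g = (\<lambda>\<mu>. \<Sum>\<alpha>\<in>K. g (std_monom \<alpha>) * monomial_qsym \<alpha> \<mu>)" by blast
  moreover have "\<exists>c. fundamental_expansion (monomial_qsym \<alpha>) c" if "\<alpha> \<in> K" for \<alpha>
    using that fundamental_expansion_monomial by (auto simp: K_def)
  ultimately have "\<exists>c. fundamental_expansion g c"
    using fundamental_expansion_sum[OF fin, of "\<lambda>\<alpha>. monomial_qsym \<alpha>" "\<lambda>\<alpha>. g (std_monom \<alpha>)"]
    by metis
  thus ?thesis using fundamental_expansion_unique by blast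
qed

lemma antipode_expansion:
  assumes "fundamental_expansion g c" "finite K" "{\<alpha>. c \<alpha> \<noteq> 0} \<subseteq> K"
  shows "antipode g \<mu> =
    (\<Sum>\<alpha>\<in>K. c \<alpha> * ((-1) ^ sum_list \<alpha> * fundamental_qsym (compl_composition \<alpha>) \<mu>))"
  unfolding antipode_def fundamental_coeff_eq[OF assms(1)]
  by (rule sum.mono_neutral_left) (use assms in auto)

theorem antipode_fundamental:
  assumes "composition \<alpha>"
  shows "antipode (fundamental_qsym \<alpha>) =
    (\<lambda>\<mu>. (-1) ^ sum_list \<alpha> * fundamental_qsym (compl_composition \<alpha>) \<mu>)"
  using antipode_expansion[OF fundamental_expansion_fundamental[OF assms], of "{\<alpha>}"] by auto

theorem antipode_lincomb:
  assumes "quasisymmetric g" "quasisymmetric h"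
  shows "antipode (\<lambda>\<mu>. a * g \<mu> + b * h \<mu>) = (\<lambda>\<mu>. a * antipode g \<mu> + b * antipode h \<mu>)"
proof -
  obtain c d where cd: "fundamental_expansion g c" "fundamental_expansion h d"
    using assms[THEN quasisymmetric_fundamental_expansion] by (meson ex1_implies_ex)
  define K where "K = {\<alpha>. c \<alpha> \<noteq> 0} \<union> {\<alpha>. d \<alpha> \<noteq> 0}"
  have fin: "finite K" using cd by (auto simp: K_def fundamental_expansion_def)
  have "{\<alpha>. a * c \<alpha> + b * d \<alpha> \<noteq> 0} \<subseteq> K" "{\<alpha>. c \<alpha> \<noteq> 0} \<subseteq> K" "{\<alpha>. d \<alpha> \<noteq> 0} \<subseteq> K"
    by (auto simp: K_def)
  thus ?thesis
    using antipode_expansion[OF fundamental_expansion_lincomb[OF cd] fin]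
      antipode_expansion[OF cd(1) fin] antipode_expansion[OF cd(2) fin]
    by (simp add: fun_eq_iff sum.distrib sum_distrib_left algebra_simps)
qed

end

theory Submission
  imports Defs "HOL-Library.Product_Lexorder"
begin

text \<open>
  A base \<open>B\<close> is \<open>f\<close>-minimizing iff \<open>f a \<le> f b\<close> for all exchanges \<open>B - a + b \<in> \<B>\<close>, and it is the
  only minimizing base iff all these inequalities are strict. So \<open>F\<^sup>*\<close> is the sum over the bases of
  the generating functions of the weakly order-preserving functions on the bipartite exchange
  poset of \<open>B\<close>, and \<open>F\<close> is the sum of those of the strictly order-preserving ones. Sorting \<open>E\<close> by
  \<open>f\<close> expands both into fundamental quasisymmetric functions indexed by the linear extensions \<open>w\<close> of
  these posets. In the strict case the ties are broken against the poset and the partial sums are the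
  ascents of \<open>w\<close>; in the weak case they are broken along the poset and the partial sums are the
  descents of \<open>w\<close>, which is the complementary set. For the polynomials, the fundamental function
  with \<open>a\<close> partial sums specializes to \<open>(m + n - 1 - a) choose n\<close>, and the identity
  reduces to binomial reciprocity.
\<close>

section \<open>Rises of a list\<close>

text \<open>A rise is recorded as the length of the prefix before it, so that rise sets compare
  directly with partial sums of compositions.\<close>

definition rises :: "'b::ord list \<Rightarrow> nat set" where
  "rises xs = {i. 0 < i \<and> i < length xs \<and> xs ! (i - 1) < xs ! i}"

lemma rises_subset: "rises xs \<subseteq> {1..<length xs}"
  by (auto simp: rises_def)

lemma rises_conv_Suc: "rises xs = Suc ` {i. Suc i < length xs \<and> xs ! i < xs ! Suc i}"
proof (intro set_eqI)
  show "x \<in> rises xs \<longleftrightarrow> x \<in> Suc ` {i. Suc i < length xs \<and> xs ! i < xs ! Suc i}" for x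
    by (cases x) (auto simp: rises_def)
qed

lemma rises_Nil [simp]: "rises [] = {}"
  by (simp add: rises_def)

lemma rises_replicate [simp]: "rises (replicate a (i :: 'b::preorder)) = {}"
  by (auto simp: rises_def)

lemma rises_append:
  assumes "xs \<noteq> []" "ys \<noteq> []" "last xs < hd ys"
  shows "rises (xs @ ys) = insert (length xs) (rises xs \<union> (+) (length xs) ` rises ys)"
proof (intro set_eqI)
  fix i
  consider "i < length xs" | "i = length xs" | k where "i = length xs + Suc k"
    by (metis add_Suc_right less_imp_Suc_add linorder_neqE_nat)
  thus "i \<in> rises (xs @ ys) \<longleftrightarrow> i \<in> insert (length xs) (rises xs \<union> (+) (length xs) ` rises ys)"
  proof cases
    case 1
    thus ?thesis by (auto simp: rises_def nth_append)
  next
    case 2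
    thus ?thesis using assms
      by (auto simp: rises_def nth_append last_conv_nth hd_conv_nth)
  next
    case 3
    have "i \<in> (+) (length xs) ` rises ys \<longleftrightarrow> Suc k \<in> rises ys"
      using 3 by (auto simp: image_iff)
    thus ?thesis using 3 by (auto simp: rises_def nth_append)
  qed
qed

text \<open>Constant blocks have no rises, and consecutive blocks, nonempty because
  \<open>\<alpha>\<close> is a composition, meet in a rise. The prefix lengths at these joints are
  the partial sums.\<close>

lemma rises_concat_replicate:
  fixes "is" :: "nat list"
  shows "\<lbrakk>length is = length \<alpha>; composition \<alpha>; sorted_wrt (<) is\<rbrakk> \<Longrightarrow>
     rises (concat (map2 replicate \<alpha> is)) = partial_sums \<alpha>"
proof (induction \<alpha> arbitrary: "is" rule: induct_list012)
  case (2 a)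
  then obtain i where "is = [i]" by (cases "is") auto
  thus ?case by simp
next
  case (3 a b \<alpha>)
  then obtain i j js where "is": "is = i # j # js"
    by (cases "is"; cases "tl is") auto
  let ?ys = "concat (map2 replicate (b # \<alpha>) (j # js))"
  have "rises (replicate a i @ ?ys) = insert a ((+) a ` rises ?ys)"
    using 3 by (subst rises_append) (auto simp: "is" hd_append)
  also have "rises ?ys = partial_sums (b # \<alpha>)"
    using "3.IH"(2)[of "j # js"] "3.prems" by (simp add: "is")
  finally show ?case by (simp add: "is" partial_sums_Cons2)
qed auto

lemma sorted_concat_replicate:
  "\<lbrakk>length is = length \<alpha>; sorted is\<rbrakk> \<Longrightarrow> sorted (concat (map2 replicate \<alpha> is))"
proof (induction "is" \<alpha> rule: list_induct2)
  case (Cons i "is" a \<alpha>)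
  have "set (concat (map2 replicate \<alpha> is)) \<subseteq> set is"
    by (auto dest: set_zip_rightD)
  with Cons show ?case by (auto simp: sorted_append)
qed simp

lemma mset_concat_replicate: "mset (concat (map2 replicate \<alpha> is)) = power_monom \<alpha> is"
  by (simp add: power_monom_def mset_concat o_def case_prod_unfold)

text \<open>The sorted word of \<open>\<mu>\<close> is a concatenation of constant blocks whose
  lengths form the shape of \<open>\<mu>\<close>. Refinement of shapes thus becomes inclusion of
  rise sets.\<close>

lemma partial_sums_monom_shape:
  "partial_sums (monom_shape \<mu>) = rises (sorted_list_of_multiset \<mu>)"
proof -
  let ?is = "sorted_list_of_set (set_mset \<mu>)"
  let ?s = "concat (map2 replicate (monom_shape \<mu>) ?is)"
  have len: "length ?is = length (monom_shape \<mu>)" by (simp add: monom_shape_def)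
  have "sorted_list_of_multiset \<mu> = sorted_list_of_multiset (mset ?s)"
    by (simp only: mset_concat_replicate power_monom_shape)
  also have "\<dots> = ?s"
    using sorted_concat_replicate[OF len] by (simp add: sorted_list_of_multiset_mset sorted_sort_id)
  finally show ?thesis using rises_concat_replicate[OF len] by simp
qed

text \<open>Distinct labels leave no ties between neighbours, so each inner position rises under
  exactly one of \<open>\<kappa>\<close> and its negative.\<close>

lemma rises_negate:
  fixes \<kappa> :: "'a \<Rightarrow> int"
  assumes "distinct w" "inj_on \<kappa> (set w)"
  shows "rises (map (\<lambda>e. - \<kappa> e) w) = {1..<length w} - rises (map \<kappa> w)"
proof -
  have neq: "\<kappa> (w ! (i - 1)) \<noteq> \<kappa> (w ! i)" if "0 < i" "i < length w" for i
    using that assms inj_on_eq_iff[OF assms(2), of "w ! (i - 1)" "w ! i"]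
    by (simp add: nth_eq_iff_index_eq)
  have "i \<in> rises (map (\<lambda>e. - \<kappa> e) w) \<longleftrightarrow> i \<in> {1..<length w} - rises (map \<kappa> w)" for i
    using neq[of i] by (cases "0 < i \<and> i < length w") (auto simp: rises_def)
  thus ?thesis by blast
qed

section \<open>Compositions from sets of partial sums\<close>

definition set_composition :: "nat \<Rightarrow> nat set \<Rightarrow> nat list" where
  "set_composition n A = (SOME \<beta>. composition \<beta> \<and> sum_list \<beta> = n \<and> partial_sums \<beta> = A)"

lemma set_composition:
  assumes "A \<subseteq> {1..<n}"
  shows "composition (set_composition n A)" "sum_list (set_composition n A) = n"
    "partial_sums (set_composition n A) = A"
  using someI_ex[OF composition_of_partial_sums[OF assms]] by (auto simp: set_composition_def)

lemma compl_set_composition: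
  assumes "A \<subseteq> {1..<n}"
  shows "compl_composition (set_composition n A) = set_composition n ({1..<n} - A)"
  using assms by (intro composition_eqI) (simp_all add: compl_composition set_composition)

text \<open>Refinement is inclusion of partial sums, and those of a shape are the rises of the
  sorted word. A fundamental function therefore enumerates sorted words with forced rises at
  \<open>A\<close>.\<close>

lemma fundamental_set_composition:
  assumes "A \<subseteq> {1..<n}"
  shows "fundamental_qsym (set_composition n A) \<mu> =
    of_bool (0 \<notin># \<mu> \<and> size \<mu> = n \<and> A \<subseteq> rises (sorted_list_of_multiset \<mu>))"
  using set_composition[OF assms]
  by (simp add: fundamental_qsym_eq refines_def partial_sums_monom_shape size_eq_sum_monom_shape)

text \<open>The \<open>\<alpha> i\<close> may coincide, so the coefficients that
  \<open>antipode\<close> reads off are the multiplicities \<open>c\<close>; both sums over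
  \<open>I\<close> are regrouped by the value of \<open>\<alpha>\<close>.\<close>

lemma antipode_sum_fundamental:
  assumes "finite I" "\<And>i. i \<in> I \<Longrightarrow> composition (\<alpha> i)"
  shows "antipode (\<lambda>\<mu>. \<Sum>i\<in>I. fundamental_qsym (\<alpha> i) \<mu>) =
    (\<lambda>\<mu>. \<Sum>i\<in>I. (-1) ^ sum_list (\<alpha> i) * fundamental_qsym (compl_composition (\<alpha> i)) \<mu>)"
proof -
  define c where "c \<beta> = int (card {i \<in> I. \<alpha> i = \<beta>})" for \<beta>
  have group: "(\<Sum>i\<in>I. h (\<alpha> i)) = (\<Sum>\<beta>\<in>\<alpha> ` I. c \<beta> * h \<beta>)" for h :: "nat list \<Rightarrow> int"
    using assms(1) by (subst sum.image_gen[of I _ \<alpha>]) (auto simp: c_def)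
  have supp: "c \<beta> = 0" if "\<beta> \<notin> \<alpha> ` I" for \<beta>
    using that by (auto simp: c_def card_eq_0_iff)
  have "fundamental_expansion (\<lambda>\<mu>. \<Sum>i\<in>I. fundamental_qsym (\<alpha> i) \<mu>) c"
  proof (rule fundamental_expansionI[of "\<alpha> ` I"])
    show "(\<Sum>i\<in>I. fundamental_qsym (\<alpha> i) \<mu>) = (\<Sum>\<beta>\<in>\<alpha> ` I. c \<beta> * fundamental_qsym \<beta> \<mu>)" for \<mu>
      by (rule group)
  qed (use assms supp in auto)
  from antipode_expansion[OF this, of "\<alpha> ` I"] show ?thesis
    using assms(1) supp
      group[of "\<lambda>\<beta>. (-1) ^ sum_list \<beta> * fundamental_qsym (compl_composition \<beta>) _"]
    by (auto simp: fun_eq_iff)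
qed

section \<open>Order-preserving functions and linear extensions\<close>

definition linear_extensions :: "'a set \<Rightarrow> ('a \<times> 'a) set \<Rightarrow> 'a list set" where
  "linear_extensions E R = {w. distinct w \<and> set w = E \<and> sorted_wrt (\<lambda>x y. (y, x) \<notin> R) w}"

text \<open>The functions respecting \<open>R\<close>, strictly or weakly on a pair according to how \<open>\<kappa>\<close> breaks
  the tie.\<close>

definition order_functions ::
    "'a set \<Rightarrow> ('a \<times> 'a) set \<Rightarrow> ('a \<Rightarrow> int) \<Rightarrow> ('a \<Rightarrow> nat) set" where
  "order_functions E R \<kappa> =
     {f \<in> E \<rightarrow>\<^sub>E {1..}. \<forall>(a, b) \<in> R. (f a, \<kappa> a) < (f b, \<kappa> b)}"

lemma finite_linear_extensions:
  assumes "finite E"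
  shows "finite (linear_extensions E R)"
proof (rule finite_subset)
  show "linear_extensions E R \<subseteq> {w. set w \<subseteq> E \<and> length w = card E}"
    by (auto simp: linear_extensions_def distinct_card)
  show "finite {w. set w \<subseteq> E \<and> length w = card E}"
    using assms by (rule finite_lists_length_eq)
qed

text \<open>By transitivity only neighbours matter. They never tie in \<open>\<kappa>\<close>, so
  \<open>f\<close> may stay constant only where \<open>\<kappa>\<close> increases and must increase
  strictly where \<open>- \<kappa>\<close> does.\<close>

lemma sorted_wrt_lex_iff:
  fixes f :: "'a \<Rightarrow> nat" and \<kappa> :: "'a \<Rightarrow> int"
  assumes "distinct w" "inj_on \<kappa> (set w)"
  shows "sorted_wrt (\<lambda>x y. (f x, \<kappa> x) < (f y, \<kappa> y)) w \<longleftrightarrow>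
    sorted (map f w) \<and> rises (map (\<lambda>e. - \<kappa> e) w) \<subseteq> rises (map f w)"
proof -
  have neq: "\<kappa> (w ! i) \<noteq> \<kappa> (w ! Suc i)" if "Suc i < length w" for i
    using that assms inj_on_eq_iff[OF assms(2), of "w ! i" "w ! Suc i"]
    by (simp add: nth_eq_iff_index_eq)
  have "sorted_wrt (\<lambda>x y. (f x, \<kappa> x) < (f y, \<kappa> y)) w \<longleftrightarrow>
      (\<forall>i. Suc i < length w \<longrightarrow> (f (w ! i), \<kappa> (w ! i)) < (f (w ! Suc i), \<kappa> (w ! Suc i)))"
    by (rule sorted_wrt_iff_nth_Suc_transp) (auto intro!: transpI)
  also have "\<dots> \<longleftrightarrow> (\<forall>i. Suc i < length w \<longrightarrow> f (w ! i) \<le> f (w ! Suc i) \<and>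
      (- \<kappa> (w ! i) < - \<kappa> (w ! Suc i) \<longrightarrow> f (w ! i) < f (w ! Suc i)))"
    using neq by (force simp: less_le)
  also have "\<dots> \<longleftrightarrow> sorted (map f w) \<and> rises (map (\<lambda>e. - \<kappa> e) w) \<subseteq> rises (map f w)"
  proof -
    have "sorted (map f w) \<longleftrightarrow> (\<forall>i. Suc i < length w \<longrightarrow> f (w ! i) \<le> f (w ! Suc i))"
      by (auto simp: sorted_iff_nth_Suc)
    moreover have "rises (map (\<lambda>e. - \<kappa> e) w) \<subseteq> rises (map f w) \<longleftrightarrow>
        (\<forall>i. Suc i < length w \<longrightarrow> - \<kappa> (w ! i) < - \<kappa> (w ! Suc i) \<longrightarrow> f (w ! i) < f (w ! Suc i))"
      unfolding rises_conv_Suc inj_image_subset_iff[OF inj_Suc] by auto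
    ultimately show ?thesis by blast
  qed
  finally show ?thesis .
qed

lemma ex1_sorted_wrt_key:
  fixes k :: "'a \<Rightarrow> 'b::linorder"
  assumes "finite E" "inj_on k E"
  shows "\<exists>!w. distinct w \<and> set w = E \<and> sorted_wrt (\<lambda>x y. k x < k y) w"
proof (rule ex_ex1I)
  obtain xs where xs: "set xs = E" "distinct xs" using assms(1) finite_distinct_list by blast
  have "sorted_wrt (<) (map k (sort_key k xs))"
    using xs assms(2) by (simp add: strict_sorted_iff distinct_map)
  thus "\<exists>w. distinct w \<and> set w = E \<and> sorted_wrt (\<lambda>x y. k x < k y) w"
    using xs by (intro exI[of _ "sort_key k xs"]) (simp add: sorted_wrt_map)
next
  fix v w
  assume v: "distinct v \<and> set v = E \<and> sorted_wrt (\<lambda>x y. k x < k y) v"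
    and w: "distinct w \<and> set w = E \<and> sorted_wrt (\<lambda>x y. k x < k y) w"
  have "map k v = map k w"
    using v w by (intro strict_sorted_equal) (auto simp: sorted_wrt_map)
  thus "v = w" using v w assms(2) by (intro map_inj_on[of k v w]) auto
qed

lemma weight_monom_mset:
  "distinct w \<Longrightarrow> set w = E \<Longrightarrow> weight_monom E f = mset (map f w)"
  by (auto simp: weight_monom_def mset_set_set)

text \<open>Sorting \<open>E\<close> by \<open>f\<close>, with ties broken by \<open>\<kappa>\<close>, turns \<open>f\<close> into a linear extension along which
  the values of \<open>f\<close> increase weakly, and strictly wherever \<open>\<kappa>\<close> descends.\<close>

lemma card_order_functions:
  fixes \<kappa> :: "'a \<Rightarrow> int"
  assumes "finite E" "inj_on \<kappa> E" "R \<subseteq> E \<times> E" "irrefl R"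
  shows "int (card {f \<in> order_functions E R \<kappa>. weight_monom E f = \<mu>}) =
    (\<Sum>w\<in>linear_extensions E R.
      fundamental_qsym (set_composition (card E) (rises (map (\<lambda>e. - \<kappa> e) w))) \<mu>)"
proof -
  let ?s = "sorted_list_of_multiset \<mu>"
  let ?S = "\<lambda>f. sorted_wrt (\<lambda>x y. (f x, \<kappa> x) < (f y, \<kappa> y))"
  define X where "X = {f \<in> order_functions E R \<kappa>. weight_monom E f = \<mu>}"
  define Y where "Y = {w \<in> linear_extensions E R. 0 \<notin># \<mu> \<and> size \<mu> = card E \<and>
    rises (map (\<lambda>e. - \<kappa> e) w) \<subseteq> rises ?s}"
  define word where "word f = (THE w. distinct w \<and> set w = E \<and> ?S f w)" for f :: "'a \<Rightarrow> nat"
  have inj: "inj_on (\<lambda>x. (f x, \<kappa> x)) E" for f :: "'a \<Rightarrow> nat"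
    using assms(2) by (auto simp: inj_on_def)
  note ex1 = ex1_sorted_wrt_key[OF assms(1) inj]
  have word: "distinct (word f)" "set (word f) = E" "?S f (word f)" for f
    using theI'[OF ex1[of f]] by (auto simp: word_def)
  have word_eq: "word f = w" if "distinct w" "set w = E" "?S f w" for f w
    using ex1[of f] that word[of f] by blast
  have map_word: "map f (word f) = ?s" if "f \<in> X" for f
  proof -
    have "sorted (map f (word f))"
      using word[of f] sorted_wrt_lex_iff[of "word f" \<kappa> f] assms(2) by simp
    moreover have "mset (map f (word f)) = \<mu>"
      using that weight_monom_mset[OF word(1,2)] by (simp add: X_def)
    ultimately show ?thesis
      by (metis sorted_list_of_multiset_mset sorted_sort_id)
  qed
  have "bij_betw word X Y"
  proof (rule bij_betw_imageI)
    show "inj_on word X"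
    proof (rule inj_onI)
      fix f g assume fg: "f \<in> X" "g \<in> X" "word f = word g"
      hence "map f (word f) = map g (word f)" using map_word by metis
      hence "f e = g e" if "e \<in> E" for e using word(2)[of f] that by auto
      thus "f = g" using fg
        by (auto simp: X_def order_functions_def intro: PiE_ext)
    qed
    show "word ` X = Y"
    proof (intro equalityI subsetI)
      fix w assume "w \<in> word ` X"
      then obtain f where f: "f \<in> X" "w = word f" by blast
      have E: "f e \<noteq> 0" if "e \<in> E" for e
        using f that by (force simp: X_def order_functions_def)
      have \<mu>: "\<mu> = mset (map f w)"
        using f weight_monom_mset[OF word(1,2)] by (simp add: X_def)
      \<comment> \<open>A pair of \<open>R\<close> occurring backwards in \<open>w\<close> would
        contradict the strict lexicographic increase along \<open>w\<close>.\<close>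
      have "sorted_wrt (\<lambda>x y. (y, x) \<notin> R) w"
        using word(3)[of f] f
        by (auto simp: X_def order_functions_def elim!: sorted_wrt_mono_rel[rotated])
      moreover have "rises (map (\<lambda>e. - \<kappa> e) w) \<subseteq> rises ?s"
        using word[of f] sorted_wrt_lex_iff[of w \<kappa> f] assms(2) map_word[OF f(1)] f(2) by simp
      moreover have "size \<mu> = card E"
        using \<mu> f(2) word(1,2)[of f] by (simp add: distinct_card[symmetric])
      moreover have "0 \<notin># \<mu>"
        using \<mu> f(2) word(2)[of f] E by force
      ultimately show "w \<in> Y" using word f by (simp add: Y_def linear_extensions_def)
    next
      fix w assume w: "w \<in> Y"
      hence dw: "distinct w" "set w = E" "sorted_wrt (\<lambda>x y. (y, x) \<notin> R) w"
        by (auto simp: Y_def linear_extensions_def)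
      have len: "length w = length ?s"
        using w distinct_card[OF dw(1)] dw(2) size_mset[of ?s]
        by (simp add: Y_def del: size_mset)
      \<comment> \<open>The preimage of \<open>w\<close>: the entries of the sorted word of
        \<open>\<mu>\<close> are assigned to the elements of \<open>w\<close> position by
        position.\<close>
      define f where "f = restrict (\<lambda>e. the (map_of (zip w ?s) e)) E"
      have mf: "map f w = ?s"
        using dw len by (intro nth_equalityI) (auto simp: f_def map_of_zip_nth)
      have S: "?S f w"
        using w dw sorted_wrt_lex_iff[of w \<kappa> f] assms(2) mf
        by (simp add: Y_def)
      have "f e \<in> {1..}" if "e \<in> E" for e
      proof -
        have "f e \<in> set ?s" using mf that dw by (metis image_eqI set_map)
        moreover have "0 \<notin> set ?s" using w by (simp add: Y_def)
        ultimately have "f e \<noteq> 0" by metis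
        thus ?thesis by simp
      qed
      hence "f \<in> E \<rightarrow>\<^sub>E {1..}" by (auto simp: f_def)
      \<comment> \<open>Irreflexivity puts \<open>a\<close> and \<open>b\<close> at different
        positions, the linear extension puts \<open>a\<close> first, and the pairs increase strictly
        along \<open>w\<close>.\<close>
      moreover have "(f a, \<kappa> a) < (f b, \<kappa> b)" if "(a, b) \<in> R" for a b
      proof -
        have "a \<in> set w" "b \<in> set w" using that assms(3) dw(2) by auto
        then obtain i j where ij: "i < length w" "j < length w" "w ! i = a" "w ! j = b"
          unfolding in_set_conv_nth by blast
        have "i \<noteq> j" using ij that assms(4) by (auto simp: irrefl_def)
        moreover have "\<not> j < i"
          using sorted_wrt_nth_less[OF dw(3), of j i] ij that by auto
        ultimately show ?thesis
          using sorted_wrt_nth_less[OF S, of i j] ij by simp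
      qed
      moreover have "weight_monom E f = \<mu>"
        using weight_monom_mset[OF dw(1,2), of f] mf by simp
      ultimately have "f \<in> X" by (auto simp: X_def order_functions_def)
      moreover have "word f = w" using word_eq dw S by blast
      ultimately show "w \<in> word ` X" by blast
    qed
  qed
  hence "card X = card Y" by (rule bij_betw_same_card)
  also have "int (card Y) = (\<Sum>w\<in>linear_extensions E R. of_bool (0 \<notin># \<mu> \<and> size \<mu> = card E \<and>
      rises (map (\<lambda>e. - \<kappa> e) w) \<subseteq> rises ?s))"
    using finite_linear_extensions[OF assms(1)] by (simp add: Y_def Int_def)
  also have "\<dots> = (\<Sum>w\<in>linear_extensions E R.
      fundamental_qsym (set_composition (card E) (rises (map (\<lambda>e. - \<kappa> e) w))) \<mu>)"
  proof (rule sum.cong[OF refl])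
    fix w assume "w \<in> linear_extensions E R"
    hence "length w = card E" by (auto simp: linear_extensions_def distinct_card)
    hence "rises (map (\<lambda>e. - \<kappa> e) w) \<subseteq> {1..<card E}"
      using rises_subset[of "map (\<lambda>e. - \<kappa> e) w"] by simp
    thus "of_bool (0 \<notin># \<mu> \<and> size \<mu> = card E \<and> rises (map (\<lambda>e. - \<kappa> e) w) \<subseteq> rises ?s) =
        fundamental_qsym (set_composition (card E) (rises (map (\<lambda>e. - \<kappa> e) w))) \<mu>"
      by (simp add: fundamental_set_composition)
  qed
  finally show ?thesis by (simp add: X_def)
qed

section \<open>Minimizing bases and exchanges\<close>

text \<open>All pairs lead from \<open>B\<close> to its complement, so the relation is vacuously
  transitive and is itself the strict order of the exchange poset.\<close>

definition exchanges :: "'a set \<Rightarrow> 'a set set \<Rightarrow> 'a set \<Rightarrow> ('a \<times> 'a) set" where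
  "exchanges E \<B> B = {(a, b). a \<in> B \<and> b \<in> E - B \<and> insert b (B - {a}) \<in> \<B>}"

lemma matroid_exchange:
  assumes "matroid E \<B>" "A \<in> \<B>" "B \<in> \<B>" "a \<in> A - B"
  obtains b where "b \<in> B - A" "insert b (A - {a}) \<in> \<B>"
proof -
  have "\<forall>A\<in>\<B>. \<forall>B\<in>\<B>. \<forall>a\<in>A - B. \<exists>b\<in>B - A. insert b (A - {a}) \<in> \<B>"
    using assms(1) by (simp add: matroid_def)
  from bspec[OF bspec[OF bspec[OF this assms(2)] assms(3)] assms(4)] show ?thesis
    using that by blast
qed

lemma matroid_finite:
  assumes "matroid E \<B>"
  shows "finite E" "finite \<B>" "\<And>B. B \<in> \<B> \<Longrightarrow> B \<subseteq> E" "\<And>B. B \<in> \<B> \<Longrightarrow> finite B"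
proof -
  show E: "finite E" and sub: "\<And>B. B \<in> \<B> \<Longrightarrow> B \<subseteq> E"
    using assms by (auto simp: matroid_def)
  show "finite \<B>" using sub E by (meson PowI finite_Pow_iff finite_subset subsetI)
  show "\<And>B. B \<in> \<B> \<Longrightarrow> finite B" using sub E finite_subset by blast
qed

text \<open>Written with additions on both sides because subtraction of naturals truncates.\<close>

lemma sum_exchange:
  fixes f :: "'a \<Rightarrow> nat"
  assumes "finite B" "a \<in> B" "b \<notin> B"
  shows "sum f (insert b (B - {a})) + f a = sum f B + f b"
  using assms sum.remove[of B a f] by simp

lemma exists_minimizing_base:
  assumes "matroid E \<B>"
  obtains B where "B \<in> minimizing_bases \<B> f"
proof -
  have "\<B> \<noteq> {}" using assms by (auto simp: matroid_def)
  with matroid_finite(2)[OF assms] obtain B where "is_arg_min (sum f) (\<lambda>B. B \<in> \<B>) B"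
    using ex_is_arg_min_if_finite by blast
  thus ?thesis using that by (auto simp: minimizing_bases_def is_arg_min_linorder)
qed

lemma minimizing_base_exchange:
  assumes "matroid E \<B>" "B \<in> minimizing_bases \<B> f" "a \<in> B" "b \<notin> B" "insert b (B - {a}) \<in> \<B>"
  shows "f a \<le> f b"
proof -
  have "sum f B \<le> sum f (insert b (B - {a}))" "finite B"
    using assms matroid_finite(4) by (auto simp: minimizing_bases_def)
  thus ?thesis using sum_exchange[of B a b f] assms(3,4) by simp
qed

text \<open>Compare \<open>B\<close> with another base \<open>C\<close> at an element of their symmetric difference where \<open>f\<close> is
  largest: the local condition on \<open>B\<close> provides such an element in \<open>C - B\<close>, and exchanging it moves
  \<open>C\<close> towards \<open>B\<close> without increasing its weight.\<close>

lemma exchange_towards_base: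
  fixes f :: "'a \<Rightarrow> nat"
  assumes M: "matroid E \<B>" and B: "B \<in> \<B>" and C: "C \<in> \<B>" and "B \<noteq> C"
    and loc: "\<And>a b. (a, b) \<in> exchanges E \<B> B \<Longrightarrow> f a \<le> f b"
  obtains x y where "x \<in> C - B" "y \<in> B - C" "insert y (C - {x}) \<in> \<B>" "f y \<le> f x"
    "\<And>z. z \<in> (B - C) \<union> (C - B) \<Longrightarrow> f z \<le> f x"
proof -
  define D where "D = (B - C) \<union> (C - B)"
  have D: "finite D" "D \<noteq> {}" using M B C \<open>B \<noteq> C\<close> matroid_finite(4)[OF M] by (auto simp: D_def)
  have "Max (f ` D) \<in> f ` D" using D by (intro Max_in) auto
  then obtain u where u: "u \<in> D" "f u = Max (f ` D)" by auto
  have max: "f z \<le> f u" if "z \<in> D" for z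
    using u D that by simp
  obtain x where x: "x \<in> C - B" "f x = f u"
  proof (cases "u \<in> B")
    case True
    hence "u \<in> B - C" using u by (auto simp: D_def)
    from matroid_exchange[OF M B C this] obtain v
      where v: "v \<in> C - B" "insert v (B - {u}) \<in> \<B>" .
    hence "f u \<le> f v"
      using True C matroid_finite(3)[OF M] by (intro loc) (auto simp: exchanges_def)
    thus ?thesis using that[of v] v max[of v] by (auto simp: D_def)
  next
    case False
    thus ?thesis using that[of u] u by (auto simp: D_def)
  qed
  from matroid_exchange[OF M C B x(1)] obtain y
    where "y \<in> B - C" "insert y (C - {x}) \<in> \<B>" .
  thus ?thesis using that[of x y] x max by (auto simp: D_def)
qed

text \<open>Local optimality suffices because any minimizing base \<open>C\<close> can be walked to
  \<open>B\<close>: each exchange from \<open>exchange_towards_base\<close> keeps \<open>C\<close>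
  minimizing and shrinks \<open>C - B\<close>.\<close>

lemma minimizing_base_iff:
  assumes M: "matroid E \<B>"
  shows "B \<in> minimizing_bases \<B> f \<longleftrightarrow>
    B \<in> \<B> \<and> (\<forall>(a, b) \<in> exchanges E \<B> B. f a \<le> f b)" (is "?L \<longleftrightarrow> ?R")
proof
  assume ?L
  thus ?R using minimizing_base_exchange[OF M, of B f]
    by (auto simp: exchanges_def minimizing_bases_def)
next
  assume R: ?R
  have "B \<in> minimizing_bases \<B> f" if "C \<in> minimizing_bases \<B> f" for C
    using that
  proof (induction "card (C - B)" arbitrary: C rule: less_induct)
    case less
    show ?case
    proof (cases "B = C")
      case False
      have C: "C \<in> \<B>" "\<And>C'. C' \<in> \<B> \<Longrightarrow> sum f C \<le> sum f C'"
        using less.prems by (auto simp: minimizing_bases_def)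
      have fin: "finite C" using C matroid_finite(4)[OF M] by blast
      obtain x y where xy: "x \<in> C - B" "y \<in> B - C" "insert y (C - {x}) \<in> \<B>" "f y \<le> f x"
        by (rule exchange_towards_base[OF M _ C(1) False, of f]) (use R in auto)
      have "insert y (C - {x}) - B \<subset> C - B" using xy by auto
      hence "card (insert y (C - {x}) - B) < card (C - B)"
        using fin by (intro psubset_card_mono) auto
      moreover have "sum f (insert y (C - {x})) \<le> sum f C"
        using sum_exchange[of C x y f] xy fin by simp
      hence "insert y (C - {x}) \<in> minimizing_bases \<B> f"
        using xy(3) C(2) by (auto simp: minimizing_bases_def intro: order_trans)
      ultimately show ?thesis by (rule less.hyps)
    qed (use less in simp)
  qed
  thus ?L using exists_minimizing_base[OF M, of f] by blast
qed

text \<open>An exchange that is not strict would turn the minimizing base into a second one.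
  Conversely, a second minimizing base is refuted at an element of largest value in the symmetric
  difference.\<close>

lemma unique_minimizing_base_iff:
  assumes M: "matroid E \<B>"
  shows "minimizing_bases \<B> f = {B} \<longleftrightarrow>
    B \<in> \<B> \<and> (\<forall>(a, b) \<in> exchanges E \<B> B. f a < f b)" (is "?L \<longleftrightarrow> ?R")
proof
  assume L: ?L
  have B: "B \<in> \<B>" using L by (auto simp: minimizing_bases_def)
  have "f a < f b" if "(a, b) \<in> exchanges E \<B> B" for a b
  proof (rule ccontr)
    assume "\<not> f a < f b"
    define C where "C = insert b (B - {a})"
    have C: "C \<in> \<B>" "C \<noteq> B" and ab: "a \<in> B" "b \<notin> B"
      using that by (auto simp: exchanges_def C_def)
    have "sum f C \<le> sum f B"
      using sum_exchange[of B a b f] ab matroid_finite(4)[OF M B] \<open>\<not> f a < f b\<close>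
      by (simp add: C_def)
    moreover have "sum f B \<le> sum f C'" if "C' \<in> \<B>" for C'
      using L that by (auto simp: minimizing_bases_def)
    ultimately have "C \<in> minimizing_bases \<B> f"
      using C(1) by (auto simp: minimizing_bases_def intro: order_trans)
    thus False using L C(2) by simp
  qed
  thus ?R using B by auto
next
  assume R: ?R
  hence loc: "f a \<le> f b" if "(a, b) \<in> exchanges E \<B> B" for a b
    using that by fastforce
  hence "B \<in> minimizing_bases \<B> f" using R by (auto simp: minimizing_base_iff[OF M])
  moreover have "C = B" if min: "C \<in> minimizing_bases \<B> f" for C
  proof (rule ccontr)
    assume "C \<noteq> B"
    have C: "C \<in> \<B>" using min by (auto simp: minimizing_bases_def)
    \<comment> \<open>The contradiction is the cycle \<open>f x \<le> f y < f v \<le> f x\<close>: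
      minimality of \<open>C\<close>, strictness of the exchange of \<open>y\<close> for
      \<open>v\<close> in \<open>B\<close>, and maximality of \<open>f x\<close> on the symmetric
      difference.\<close>
    obtain x y where xy: "x \<in> C - B" "y \<in> B - C" "insert y (C - {x}) \<in> \<B>"
      "\<And>z. z \<in> (B - C) \<union> (C - B) \<Longrightarrow> f z \<le> f x"
      using exchange_towards_base[OF M _ C, of B f] R loc \<open>C \<noteq> B\<close> by metis
    have "f x \<le> f y"
      using minimizing_base_exchange[OF M min, of x y] xy by auto
    moreover obtain v where v: "v \<in> C - B" "insert v (B - {y}) \<in> \<B>"
      using matroid_exchange[OF M _ C xy(2)] R by blast
    have "f y < f v"
      using v xy(2) C R matroid_finite(3)[OF M C] by (auto simp: exchanges_def)
    moreover have "f v \<le> f x" using v xy(4) by blast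
    ultimately show False by simp
  qed
  ultimately show ?L by blast
qed

lemma generic_iff: "generic \<B> f \<longleftrightarrow> (\<exists>B. minimizing_bases \<B> f = {B})"
proof
  assume "generic \<B> f"
  then obtain B where "B \<in> minimizing_bases \<B> f" "\<forall>C. C \<in> minimizing_bases \<B> f \<longrightarrow> C = B"
    unfolding generic_def by (elim ex1E) rule
  hence "minimizing_bases \<B> f = {B}" by blast
  thus "\<exists>B. minimizing_bases \<B> f = {B}" ..
qed (auto simp: generic_def)

section \<open>Fundamental expansions of the two matroid series\<close>

lemma finite_weight_functions:
  assumes "finite E"
  shows "finite {f \<in> E \<rightarrow>\<^sub>E {1..}. weight_monom E f = \<mu>}"
proof (rule finite_subset)
  show "{f \<in> E \<rightarrow>\<^sub>E {1..}. weight_monom E f = \<mu>} \<subseteq> E \<rightarrow>\<^sub>E set_mset \<mu>"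
  proof
    fix f assume "f \<in> {f \<in> E \<rightarrow>\<^sub>E {1..}. weight_monom E f = \<mu>}"
    hence "f \<in> extensional E" "\<mu> = image_mset f (mset_set E)"
      by (auto simp: weight_monom_def PiE_def)
    thus "f \<in> E \<rightarrow>\<^sub>E set_mset \<mu>" using assms by (auto simp: PiE_def)
  qed
  show "finite (E \<rightarrow>\<^sub>E set_mset \<mu>)" using assms by (intro finite_PiE) auto
qed

text \<open>An enumeration of \<open>E\<close> from 0, lowered by \<open>card E\<close> on
  \<open>B\<close>, is negative on \<open>B\<close> and nonnegative off it. It is a natural
  labelling of the exchange poset; its negative breaks ties against the poset.\<close>

lemma exists_base_label:
  assumes "finite E"
  shows "\<exists>\<kappa> :: 'a \<Rightarrow> int. inj_on \<kappa> E \<and> (\<forall>a \<in> B \<inter> E. \<forall>b \<in> E - B. \<kappa> a < \<kappa> b)"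
proof -
  obtain h where h: "bij_betw h E {0..<card E}"
    using ex_bij_betw_finite_nat[OF assms] by blast
  have inj: "inj_on h E" and lt: "h e < card E" if "e \<in> E" for e
    using h that by (auto simp: bij_betw_def)
  let ?\<kappa> = "\<lambda>e. int (h e) - (if e \<in> B then int (card E) else 0)"
  have "e = e'" if "e \<in> E" "e' \<in> E" "?\<kappa> e = ?\<kappa> e'" for e e'
    using that lt[of e] lt[of e'] inj[OF that(1)] by (auto split: if_splits dest: inj_onD)
  hence "inj_on ?\<kappa> E" by (blast intro: inj_onI)
  moreover have "?\<kappa> a < ?\<kappa> b" if "a \<in> B \<inter> E" "b \<in> E - B" for a b
    using that lt[of a] by simp
  ultimately show ?thesis by blast
qed

context
  fixes E :: "'a set" and \<B> :: "'a set set" and \<kappa> :: "'a set \<Rightarrow> 'a \<Rightarrow> int"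
  assumes M: "matroid E \<B>"
    and inj: "\<And>B. B \<in> \<B> \<Longrightarrow> inj_on (\<kappa> B) E"
    and mono: "\<And>B a b. \<lbrakk>B \<in> \<B>; a \<in> B; b \<in> E - B\<rbrakk> \<Longrightarrow> \<kappa> B a < \<kappa> B b"
begin

lemma exchanges_subset: "B \<in> \<B> \<Longrightarrow> exchanges E \<B> B \<subseteq> E \<times> E"
  using matroid_finite(3)[OF M] by (auto simp: exchanges_def)

lemma irrefl_exchanges: "irrefl (exchanges E \<B> B)"
  by (auto simp: irrefl_def exchanges_def)

text \<open>With the negated label the lower element of an exchange pair loses every tie, so only
  strict inequalities of \<open>f\<close> remain.\<close>

lemma strict_order_functions:
  assumes "B \<in> \<B>"
  shows "order_functions E (exchanges E \<B> B) (\<lambda>e. - \<kappa> B e) =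
    {f \<in> E \<rightarrow>\<^sub>E {1..}. minimizing_bases \<B> f = {B}}"
proof -
  have "(f a, - \<kappa> B a) < (f b, - \<kappa> B b) \<longleftrightarrow> f a < f b"
    if "(a, b) \<in> exchanges E \<B> B" for a b and f :: "'a \<Rightarrow> nat"
    using that mono[OF assms, of a b] by (auto simp: exchanges_def)
  hence "(\<forall>(a, b) \<in> exchanges E \<B> B. (f a, - \<kappa> B a) < (f b, - \<kappa> B b)) \<longleftrightarrow>
      (\<forall>(a, b) \<in> exchanges E \<B> B. f a < f b)" for f :: "'a \<Rightarrow> nat"
    by (intro ball_cong) auto
  thus ?thesis
    using assms by (simp add: order_functions_def unique_minimizing_base_iff[OF M])
qed

lemma weak_order_functions:
  assumes "B \<in> \<B>"
  shows "order_functions E (exchanges E \<B> B) (\<kappa> B) =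
    {f \<in> E \<rightarrow>\<^sub>E {1..}. B \<in> minimizing_bases \<B> f}"
proof -
  have "(f a, \<kappa> B a) < (f b, \<kappa> B b) \<longleftrightarrow> f a \<le> f b"
    if "(a, b) \<in> exchanges E \<B> B" for a b and f :: "'a \<Rightarrow> nat"
    using that mono[OF assms, of a b] by (auto simp: exchanges_def)
  hence "(\<forall>(a, b) \<in> exchanges E \<B> B. (f a, \<kappa> B a) < (f b, \<kappa> B b)) \<longleftrightarrow>
      (\<forall>(a, b) \<in> exchanges E \<B> B. f a \<le> f b)" for f :: "'a \<Rightarrow> nat"
    by (intro ball_cong) auto
  thus ?thesis
    using assms by (simp add: order_functions_def minimizing_base_iff[OF M])
qed

text \<open>A generic function has exactly one minimizing base, so the count splits into a disjoint
  union over bases. Tie-breaking by \<open>- \<kappa> B\<close> leaves the rises of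
  \<open>\<kappa> B\<close> after double negation.\<close>

lemma matroid_F_expansion:
  "matroid_F E \<B> \<mu> = (\<Sum>B\<in>\<B>. \<Sum>w\<in>linear_extensions E (exchanges E \<B> B).
     fundamental_qsym (set_composition (card E) (rises (map (\<kappa> B) w))) \<mu>)"
proof -
  let ?X = "\<lambda>B. {f \<in> order_functions E (exchanges E \<B> B) (\<lambda>e. - \<kappa> B e). weight_monom E f = \<mu>}"
  have "{f \<in> E \<rightarrow>\<^sub>E {1..}. generic \<B> f \<and> weight_monom E f = \<mu>} = (\<Union>B\<in>\<B>. ?X B)"
    by (auto simp: strict_order_functions generic_iff minimizing_bases_def)
  hence "matroid_F E \<B> \<mu> = int (card (\<Union>B\<in>\<B>. ?X B))" by (simp add: matroid_F_def)
  also have "card (\<Union>B\<in>\<B>. ?X B) = (\<Sum>B\<in>\<B>. card (?X B))"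
  proof (rule card_UN_disjoint)
    show "\<forall>B\<in>\<B>. finite (?X B)"
      by (intro ballI finite_subset[OF _ finite_weight_functions[OF matroid_finite(1)[OF M], of \<mu>]])
        (auto simp: order_functions_def)
    show "\<forall>B\<in>\<B>. \<forall>C\<in>\<B>. B \<noteq> C \<longrightarrow> ?X B \<inter> ?X C = {}"
      by (auto simp: strict_order_functions)
  qed (rule matroid_finite(2)[OF M])
  also have "int \<dots> = (\<Sum>B\<in>\<B>. \<Sum>w\<in>linear_extensions E (exchanges E \<B> B).
     fundamental_qsym (set_composition (card E) (rises (map (\<kappa> B) w))) \<mu>)"
  proof (subst of_nat_sum, rule sum.cong[OF refl])
    fix B assume B: "B \<in> \<B>"
    have "inj_on (\<lambda>e. - \<kappa> B e) E" using inj[OF B] by (auto simp: inj_on_def)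
    from card_order_functions[OF matroid_finite(1)[OF M] this exchanges_subset[OF B] irrefl_exchanges]
    show "int (card (?X B)) = (\<Sum>w\<in>linear_extensions E (exchanges E \<B> B).
        fundamental_qsym (set_composition (card E) (rises (map (\<kappa> B) w))) \<mu>)" by simp
  qed
  finally show ?thesis .
qed

text \<open>Double counting of the pairs of a function and one of its minimizing bases: for fixed
  \<open>B\<close> the functions are those respecting the exchange poset weakly.\<close>

lemma matroid_Fstar_expansion:
  "matroid_Fstar E \<B> \<mu> = (\<Sum>B\<in>\<B>. \<Sum>w\<in>linear_extensions E (exchanges E \<B> B).
     fundamental_qsym (set_composition (card E) (rises (map (\<lambda>e. - \<kappa> B e) w))) \<mu>)"
proof -
  let ?X = "{f. f \<in> E \<rightarrow>\<^sub>E {1..} \<and> weight_monom E f = \<mu>}"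
  have fin: "finite ?X" using finite_weight_functions[OF matroid_finite(1)[OF M]] by simp
  have "minimizing_bases \<B> f = {B \<in> \<B>. B \<in> minimizing_bases \<B> f}" for f
    by (auto simp: minimizing_bases_def)
  hence "int (card (minimizing_bases \<B> f)) = (\<Sum>B\<in>\<B>. of_bool (B \<in> minimizing_bases \<B> f))" for f
    using matroid_finite(2)[OF M] by (simp add: Int_def)
  hence "matroid_Fstar E \<B> \<mu> = (\<Sum>f\<in>?X. \<Sum>B\<in>\<B>. of_bool (B \<in> minimizing_bases \<B> f))"
    by (simp only: matroid_Fstar_def)
  also have "\<dots> = (\<Sum>B\<in>\<B>. \<Sum>f\<in>?X. of_bool (B \<in> minimizing_bases \<B> f))"
    by (rule sum.swap)
  also have "\<dots> = (\<Sum>B\<in>\<B>. \<Sum>w\<in>linear_extensions E (exchanges E \<B> B).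
     fundamental_qsym (set_composition (card E) (rises (map (\<lambda>e. - \<kappa> B e) w))) \<mu>)"
  proof (rule sum.cong[OF refl])
    fix B assume B: "B \<in> \<B>"
    have "{f \<in> order_functions E (exchanges E \<B> B) (\<kappa> B). weight_monom E f = \<mu>} =
        {f \<in> ?X. B \<in> minimizing_bases \<B> f}"
      using B by (auto simp: weak_order_functions)
    moreover have "(\<Sum>f\<in>?X. of_bool (B \<in> minimizing_bases \<B> f)) =
        int (card {f \<in> ?X. B \<in> minimizing_bases \<B> f})"
      using fin by (simp add: Int_def)
    ultimately show "(\<Sum>f\<in>?X. of_bool (B \<in> minimizing_bases \<B> f)) =
        (\<Sum>w\<in>linear_extensions E (exchanges E \<B> B).
          fundamental_qsym (set_composition (card E) (rises (map (\<lambda>e. - \<kappa> B e) w))) \<mu>)"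
      using card_order_functions[OF matroid_finite(1)[OF M] inj[OF B] exchanges_subset[OF B]
          irrefl_exchanges, of \<mu>] by simp
  qed
  finally show ?thesis .
qed

end

text \<open>The two expansions share one index set and have complementary sets of partial sums; all the
  reciprocity is contained in this fact.\<close>

lemma matroid_expansions:
  fixes E :: "'a set"
  assumes "matroid E \<B>"
  obtains I :: "('a set \<times> 'a list) set" and A where "finite I"
    "\<And>i. i \<in> I \<Longrightarrow> A i \<subseteq> {1..<card E}"
    "\<And>\<mu>. matroid_F E \<B> \<mu> = (\<Sum>i\<in>I. fundamental_qsym (set_composition (card E) (A i)) \<mu>)"
    "\<And>\<mu>. matroid_Fstar E \<B> \<mu> =
      (\<Sum>i\<in>I. fundamental_qsym (set_composition (card E) ({1..<card E} - A i)) \<mu>)"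
proof -
  note fin = matroid_finite[OF assms]
  define \<kappa> where "\<kappa> B = (SOME \<kappa> :: 'a \<Rightarrow> int.
    inj_on \<kappa> E \<and> (\<forall>a \<in> B \<inter> E. \<forall>b \<in> E - B. \<kappa> a < \<kappa> b))" for B
  have "inj_on (\<kappa> B) E \<and> (\<forall>a \<in> B \<inter> E. \<forall>b \<in> E - B. \<kappa> B a < \<kappa> B b)" for B
    unfolding \<kappa>_def by (rule someI_ex[OF exists_base_label[OF fin(1)]])
  note \<kappa> = conjunct1[OF this] conjunct2[OF this]
  have mono: "\<kappa> B a < \<kappa> B b" if "B \<in> \<B>" "a \<in> B" "b \<in> E - B" for B a b
    using \<kappa>(2)[of B] that fin(3) by blast
  define I where "I = (SIGMA B:\<B>. linear_extensions E (exchanges E \<B> B))"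
  define A where "A = (\<lambda>(B, w). rises (map (\<kappa> B) w))"
  have I: "length w = card E" "distinct w" "set w = E" if "(B, w) \<in> I" for B w
    using that by (auto simp: I_def linear_extensions_def distinct_card)
  show ?thesis
  proof (rule that[of I A])
    show "finite I" using fin(1,2) by (auto simp: I_def finite_linear_extensions)
    show "A i \<subseteq> {1..<card E}" if "i \<in> I" for i
    proof (cases i)
      case (Pair B w)
      thus ?thesis using rises_subset[of "map (\<kappa> B) w"] I[of B w] that by (simp add: A_def)
    qed
    show "matroid_F E \<B> \<mu> = (\<Sum>i\<in>I. fundamental_qsym (set_composition (card E) (A i)) \<mu>)" for \<mu>
      unfolding matroid_F_expansion[of E \<B> \<kappa>, OF assms \<kappa>(1) mono, simplified] I_def A_def
      using fin(1,2) by (subst sum.Sigma) (auto simp: finite_linear_extensions case_prod_unfold)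
    have "matroid_Fstar E \<B> \<mu> = (\<Sum>(B, w)\<in>I.
        fundamental_qsym (set_composition (card E) (rises (map (\<lambda>e. - \<kappa> B e) w))) \<mu>)" for \<mu>
      unfolding matroid_Fstar_expansion[of E \<B> \<kappa>, OF assms \<kappa>(1) mono, simplified] I_def
      using fin(1,2) by (subst sum.Sigma) (auto simp: finite_linear_extensions)
    \<comment> \<open>Each label is injective on \<open>E\<close>, so \<open>rises_negate\<close>
      complements the rise set termwise.\<close>
    also have "\<dots> \<mu> = (\<Sum>i\<in>I. fundamental_qsym (set_composition (card E) ({1..<card E} - A i)) \<mu>)" for \<mu>
      using \<kappa>(1) I by (intro sum.cong) (auto simp: A_def rises_negate)
    finally show "matroid_Fstar E \<B> \<mu> =
        (\<Sum>i\<in>I. fundamental_qsym (set_composition (card E) ({1..<card E} - A i)) \<mu>)" for \<mu> .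
  qed
qed

section \<open>Specialization\<close>

text \<open>Cutting \<open>A\<close> down to \<open>{1..<n}\<close> lets one fixed \<open>A\<close>
  serve all lengths in the recursion on \<open>n\<close>.\<close>

definition rising_lists :: "nat \<Rightarrow> nat set \<Rightarrow> nat \<Rightarrow> nat list set" where
  "rising_lists n A m = {s. length s = n \<and> set s \<subseteq> {1..m} \<and> sorted s \<and> A \<inter> {1..<n} \<subseteq> rises s}"

lemma finite_rising_lists: "finite (rising_lists n A m)"
  by (rule finite_subset[OF _ finite_lists_length_eq[of "{1..m}" n]]) (auto simp: rising_lists_def)

lemma rises_snoc:
  "rises (s @ [x]) = rises s \<union> (if s \<noteq> [] \<and> last s < x then {length s} else {})"
proof (intro set_eqI)
  fix i
  show "i \<in> rises (s @ [x]) \<longleftrightarrow> i \<in> rises s \<union> (if s \<noteq> [] \<and> last s < x then {length s} else {})"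
    by (cases "i = length s") (auto simp: rises_def nth_append last_conv_nth)
qed

text \<open>Split by whether the last letter is \<open>Suc m\<close>. If it is, the letters before
  it are bounded by \<open>m\<close> when a rise is forced at \<open>n\<close>, and by
  \<open>Suc m\<close> otherwise. Positive \<open>n\<close> guarantees a preceding letter.\<close>

lemma rising_lists_Suc:
  assumes "0 < n"
  shows "rising_lists (Suc n) A (Suc m) = rising_lists (Suc n) A m \<union>
    (\<lambda>s. s @ [Suc m]) ` rising_lists n A (if n \<in> A then m else Suc m)" (is "?L = ?R")
proof (intro set_eqI)
  fix t :: "nat list"
  show "t \<in> ?L \<longleftrightarrow> t \<in> ?R"
  proof (cases "length t = Suc n")
    case False
    thus ?thesis by (auto simp: rising_lists_def)
  next
    case True
    then obtain s x where t: "t = s @ [x]" "length s = n"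
      by (metis length_Suc_conv_rev)
    have s: "s \<noteq> []" using t assms by auto
    have split: "A \<inter> {1..<Suc n} = A \<inter> {1..<n} \<union> (if n \<in> A then {n} else {})"
      using assms by (auto simp: less_Suc_eq)
    have n: "n \<notin> rises s" using rises_subset[of s] t by auto
    have rises: "A \<inter> {1..<Suc n} \<subseteq> rises t \<longleftrightarrow>
        A \<inter> {1..<n} \<subseteq> rises s \<and> (n \<in> A \<longrightarrow> last s < x)"
      unfolding split t rises_snoc using s t n by auto
    have last: "sorted s \<Longrightarrow> (\<forall>y\<in>set s. y \<le> k) \<longleftrightarrow> last s \<le> k" for k
      using s by (induction s rule: rev_induct) (auto simp: sorted_append)
    have range: "set s \<subseteq> {1..k} \<longleftrightarrow> (\<forall>y\<in>set s. 1 \<le> y) \<and> (\<forall>y\<in>set s. y \<le> k)" for k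
      by auto
    have mem: "s @ [x] \<in> rising_lists (Suc n) A k \<longleftrightarrow> (\<forall>y\<in>set s. 1 \<le> y) \<and> 1 \<le> x \<and> x \<le> k \<and> sorted s \<and>
        last s \<le> x \<and> A \<inter> {1..<n} \<subseteq> rises s \<and> (n \<in> A \<longrightarrow> last s < x)" for k
      using rises last[of x] t range[of k]
      by (auto simp: rising_lists_def sorted_append intro: order_trans)
    have mem': "s \<in> rising_lists n A k \<longleftrightarrow> (\<forall>y\<in>set s. 1 \<le> y) \<and> sorted s \<and>
        last s \<le> k \<and> A \<inter> {1..<n} \<subseteq> rises s" for k
      using last[of k] t(2) range[of k] by (auto simp: rising_lists_def)
    have image: "s @ [x] \<in> (\<lambda>s. s @ [Suc m]) ` Z \<longleftrightarrow> x = Suc m \<and> s \<in> Z" for Z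
      by auto
    show ?thesis
      unfolding t(1) Un_iff image mem mem' by (cases "n \<in> A") (auto simp: le_Suc_eq)
  qed
qed

text \<open>The recursion of \<open>rising_lists_Suc\<close> is Pascal's rule, with the number of
  positions free of a forced rise added to \<open>m\<close>.\<close>

lemma card_rising_lists:
  assumes "0 < n"
  shows "card (rising_lists n A m) = (m + card ({1..<n} - A)) choose n"
  using assms
proof (induction n arbitrary: m rule: nat_induct_non_zero)
  case 1
  have "rising_lists 1 A m = (\<lambda>x. [x]) ` {1..m}"
    by (auto simp: rising_lists_def length_Suc_conv)
  thus ?case by (simp add: card_image inj_on_def)
next
  case (Suc n)
  note IH = Suc.IH
  have weak: "card ({1..<Suc n} - A) = card ({1..<n} - A) + (if n \<in> A then 0 else 1)"
  proof -
    have "{1..<Suc n} - A = (if n \<in> A then {1..<n} - A else insert n ({1..<n} - A))"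
      using Suc.hyps by (auto simp: less_Suc_eq)
    thus ?thesis by simp
  qed
  show ?case
  proof (induction m)
    case 0
    \<comment> \<open>Without letters there is no word of positive length, and the binomial vanishes
      as its upper entry is below \<open>Suc n\<close>.\<close>
    have "card ({1..<Suc n} - A) \<le> n"
      using card_mono[of "{1..<Suc n}" "{1..<Suc n} - A"] by simp
    thus ?case by (auto simp: rising_lists_def card_eq_0_iff binomial_eq_0)
  next
    case (Suc m)
    let ?m = "if n \<in> A then m else Suc m"
    have "card (rising_lists (Suc n) A (Suc m)) =
        card (rising_lists (Suc n) A m) + card ((\<lambda>s. s @ [Suc m]) ` rising_lists n A ?m)"
      unfolding rising_lists_Suc[OF \<open>0 < n\<close>]
      by (rule card_Un_disjoint) (auto simp: finite_rising_lists, auto simp: rising_lists_def)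
    also have "card ((\<lambda>s. s @ [Suc m]) ` rising_lists n A ?m) = card (rising_lists n A ?m)"
      by (rule card_image) (auto simp: inj_on_def)
    \<comment> \<open>Both cases agree: a free position \<open>n\<close> adds one to the count of
      free positions, while a forced rise lowers the bound \<open>?m\<close> by one.\<close>
    also have "\<dots> = (m + card ({1..<Suc n} - A)) choose n"
      unfolding IH weak by simp
    finally show ?case using Suc by simp
  qed
qed

text \<open>Sorting maps the multisets that contribute 1 bijectively onto
  \<open>rising_lists n A m\<close>.\<close>

lemma sum_fundamental_set_composition:
  assumes "A \<subseteq> {1..<n}"
  shows "(\<Sum>\<mu>\<in>multisets_of_size {1..m} n. fundamental_qsym (set_composition n A) \<mu>) =
    int ((m + card ({1..<n} - A)) choose n)"
proof -
  have bij: "bij_betw sorted_list_of_multiset {\<mu> \<in> multisets_of_size {1..m} n. A \<subseteq> rises (sorted_list_of_multiset \<mu>)}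
      (rising_lists n A m)"
  proof (rule bij_betwI[where g = mset])
    show "sorted_list_of_multiset \<in> {\<mu> \<in> multisets_of_size {1..m} n. A \<subseteq> rises (sorted_list_of_multiset \<mu>)} \<rightarrow>
        rising_lists n A m"
    proof
      fix \<mu> assume "\<mu> \<in> {\<mu> \<in> multisets_of_size {1..m} n. A \<subseteq> rises (sorted_list_of_multiset \<mu>)}"
      moreover have "length (sorted_list_of_multiset \<mu>) = size \<mu>"
        by (metis mset_sorted_list_of_multiset size_mset)
      ultimately show "sorted_list_of_multiset \<mu> \<in> rising_lists n A m"
        by (auto simp: rising_lists_def multisets_of_size_def)
    qed
    show "mset \<in> rising_lists n A m \<rightarrow>
        {\<mu> \<in> multisets_of_size {1..m} n. A \<subseteq> rises (sorted_list_of_multiset \<mu>)}"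
      using assms by (auto simp: rising_lists_def multisets_of_size_def sorted_sort_id Int_absorb2)
  qed (auto simp: rising_lists_def sorted_sort_id)
  have fin: "finite (multisets_of_size {1..m} n)"
    by (rule finite_multisets_of_size) simp
  have "(\<Sum>\<mu>\<in>multisets_of_size {1..m} n. fundamental_qsym (set_composition n A) \<mu>) =
      (\<Sum>\<mu>\<in>multisets_of_size {1..m} n. of_bool (A \<subseteq> rises (sorted_list_of_multiset \<mu>)))"
    by (rule sum.cong) (auto simp: fundamental_set_composition[OF assms] multisets_of_size_def)
  also have "\<dots> = int (card (rising_lists n A m))"
    using bij_betw_same_card[OF bij] fin by (simp add: Int_def)
  also have "card (rising_lists n A m) = (m + card ({1..<n} - A)) choose n"
  proof (cases "n = 0")
    case True
    have "rising_lists 0 A m = {[]}" by (auto simp: rising_lists_def)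
    thus ?thesis using True by simp
  next
    case False
    thus ?thesis using card_rising_lists by simp
  qed
  finally show ?thesis .
qed

lemma specialize_sum_fundamental:
  assumes "\<And>i. i \<in> I \<Longrightarrow> A i \<subseteq> {1..<n}"
    and g: "\<And>\<mu>. g \<mu> = (\<Sum>i\<in>I. fundamental_qsym (set_composition n (A i)) \<mu>)"
  shows "specialize g m = (\<Sum>i\<in>I. int ((m + card ({1..<n} - A i)) choose n))"
proof -
  have size: "g \<mu> = 0" if "size \<mu> \<noteq> n" for \<mu>
    unfolding g using that assms(1) by (intro sum.neutral) (simp add: fundamental_set_composition)
  \<comment> \<open>As \<open>g\<close> is homogeneous of degree \<open>n\<close>, its support over
    \<open>{1..m}\<close> extends by zero terms to the finite set of all multisets of size
    \<open>n\<close>.\<close>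
  have "specialize g m = (\<Sum>\<mu>\<in>multisets_of_size {1..m} n. g \<mu>)"
    unfolding specialize_def
    by (rule sum.mono_neutral_left)
      (use size in \<open>auto simp: multisets_of_size_def intro: finite_multisets_of_size[unfolded multisets_of_size_def]\<close>)
  also have "\<dots> = (\<Sum>i\<in>I. \<Sum>\<mu>\<in>multisets_of_size {1..m} n.
      fundamental_qsym (set_composition n (A i)) \<mu>)"
    unfolding g by (rule sum.swap)
  also have "\<dots> = (\<Sum>i\<in>I. int ((m + card ({1..<n} - A i)) choose n))"
    using assms(1) by (intro sum.cong[OF refl] sum_fundamental_set_composition)
  finally show ?thesis .
qed

section \<open>The polynomials \<open>(x + d) gchoose n\<close> and binomial reciprocity\<close>

definition binomial_poly :: "nat \<Rightarrow> nat \<Rightarrow> rat poly" where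
  "binomial_poly n d = smult (1 / fact n) (\<Prod>i<n. [:of_nat d - of_nat i, 1:])"

lemma poly_binomial_poly: "poly (binomial_poly n d) x = (x + of_nat d) gchoose n"
  by (simp add: binomial_poly_def poly_prod gbinomial_prod_rev lessThan_atLeast0 algebra_simps)

text \<open>Negating the upper entry \<open>c - x\<close> of a binomial gives
  \<open>x + n - 1 - c\<close>; for \<open>c\<close> the size of the complement of \<open>A\<close>
  in \<open>{1..<n}\<close>, the number \<open>n - 1 - c\<close> is \<open>card A\<close>.\<close>

lemma pcompose_binomial_poly:
  assumes "A \<subseteq> {1..<n}"
  shows "pcompose (binomial_poly n (card ({1..<n} - A))) [:0, -1:] =
    smult ((-1) ^ n) (binomial_poly n (card A))"
proof (cases "n = 0")
  \<comment> \<open>For \<open>n = 0\<close> the count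
    \<open>card A + card ({1..<n} - A) + 1 = n\<close> fails, but both sides are the constant
    1.\<close>
  case True
  thus ?thesis using assms by (simp add: binomial_poly_def)
next
  case False
  have "card A + card ({1..<n} - A) = card {1..<n}"
    using assms card_mono[OF _ assms] by (simp add: card_Diff_subset finite_subset)
  hence "card A + card ({1..<n} - A) + 1 = n" using False by simp
  hence n: "of_nat n = of_nat (card A) + of_nat (card ({1..<n} - A)) + (1 :: rat)"
    by (metis of_nat_1 of_nat_add)
  have "poly (pcompose (binomial_poly n (card ({1..<n} - A))) [:0, -1:]) x =
      poly (smult ((-1) ^ n) (binomial_poly n (card A))) x" for x
  proof -
    have "poly (pcompose (binomial_poly n (card ({1..<n} - A))) [:0, -1:]) x =
        (- x + of_nat (card ({1..<n} - A))) gchoose n"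
      by (simp add: poly_pcompose poly_binomial_poly)
    also have "\<dots> = (-1) ^ n * ((of_nat n - (- x + of_nat (card ({1..<n} - A))) - 1) gchoose n)"
      by (rule gbinomial_negated_upper)
    also have "of_nat n - (- x + of_nat (card ({1..<n} - A))) - 1 = x + of_nat (card A)"
      by (subst n) simp
    finally show ?thesis by (simp add: poly_binomial_poly)
  qed
  thus ?thesis using poly_eq_poly_eq_iff by blast
qed

lemma smult_sum_right: "smult c (\<Sum>i\<in>I. p i) = (\<Sum>i\<in>I. smult c (p i))"
  by (induction I rule: infinite_finite_induct) (auto simp: smult_add_right)

lemma poly_sum_binomial_poly:
  "poly (\<Sum>i\<in>I. binomial_poly n (d i)) (of_nat m) = of_int (\<Sum>i\<in>I. int ((m + d i) choose n))"
  by (simp add: poly_sum poly_binomial_poly binomial_gbinomial)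

theorem theorem6p3:
  fixes E :: "'a set" and \<B> :: "'a set set" and n :: nat
  assumes "matroid E \<B>" and "card E = n"
  shows "antipode (matroid_F E \<B>) = (\<lambda>\<mu>. (-1) ^ n * matroid_Fstar E \<B> \<mu>) \<and>
    (\<exists>p q :: rat poly.
       (\<forall>m\<ge>1. poly p (of_nat m) = of_int (phi E \<B> m)) \<and>
       (\<forall>m\<ge>1. poly q (of_nat m) = of_int (phi_star E \<B> m)) \<and>
       pcompose p [:0, -1:] = smult ((-1) ^ n) q)"
proof -
  obtain I :: "('a set \<times> 'a list) set" and A where I: "finite I"
    and A: "\<And>i. i \<in> I \<Longrightarrow> A i \<subseteq> {1..<n}"
    and F: "\<And>\<mu>. matroid_F E \<B> \<mu> = (\<Sum>i\<in>I. fundamental_qsym (set_composition n (A i)) \<mu>)"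
    and Fstar: "\<And>\<mu>. matroid_Fstar E \<B> \<mu> =
      (\<Sum>i\<in>I. fundamental_qsym (set_composition n ({1..<n} - A i)) \<mu>)"
    using matroid_expansions[OF assms(1)] unfolding assms(2) by metis
  have "antipode (matroid_F E \<B>) = antipode (\<lambda>\<mu>. \<Sum>i\<in>I. fundamental_qsym (set_composition n (A i)) \<mu>)"
    using F by (intro arg_cong[of _ _ antipode]) blast
  \<comment> \<open>All the compositions have sum \<open>n\<close>, so one common sign factors out,
    and complementing each set yields the expansion of \<open>matroid_Fstar\<close>.\<close>
  also have "\<dots> = (\<lambda>\<mu>. (-1) ^ n * matroid_Fstar E \<B> \<mu>)"
    using A set_composition[OF A]
    by (subst antipode_sum_fundamental[OF I])
      (auto simp: Fstar sum_distrib_left compl_set_composition intro!: ext sum.cong)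
  finally have antipode: "antipode (matroid_F E \<B>) = (\<lambda>\<mu>. (-1) ^ n * matroid_Fstar E \<B> \<mu>)" .
  \<comment> \<open>Each summand is shifted by its number of free positions: those outside
    \<open>A i\<close> for \<open>phi\<close>, and those in \<open>A i\<close> for
    \<open>phi_star\<close>, whose forced rises are the complement.\<close>
  define p where "p = (\<Sum>i\<in>I. binomial_poly n (card ({1..<n} - A i)))"
  define q where "q = (\<Sum>i\<in>I. binomial_poly n (card (A i)))"
  have "poly p (of_nat m) = of_int (phi E \<B> m)" for m
    unfolding p_def phi_def poly_sum_binomial_poly
    using specialize_sum_fundamental[OF A F] by simp
  moreover have "poly q (of_nat m) = of_int (phi_star E \<B> m)" for m
  proof -
    have "phi_star E \<B> m = (\<Sum>i\<in>I. int ((m + card ({1..<n} - ({1..<n} - A i))) choose n))"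
      unfolding phi_star_def by (rule specialize_sum_fundamental[OF _ Fstar]) auto
    also have "\<dots> = (\<Sum>i\<in>I. int ((m + card (A i)) choose n))"
      using A by (intro sum.cong) (simp_all add: double_diff)
    finally show ?thesis by (simp only: q_def poly_sum_binomial_poly)
  qed
  moreover have "pcompose p [:0, -1:] = smult ((-1) ^ n) q"
    unfolding p_def q_def pcompose_sum smult_sum_right
    using A by (intro sum.cong[OF refl] pcompose_binomial_poly)
  ultimately show ?thesis using antipode by blast
qed

end
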